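(* Let $K$ be a non-degenerate tetrahedral Delaunay triangulation embedded in $\mathbb{R}^3$ and let $\tau$ be an internal edge of $K$. Then the circumcentric dual $\star\tau$ is a simple, planar, convex polygon whose signed area is positive.
   Context: A tetrahedral triangulation is a finite simplicial complex of dimension $3$ embedded in $\mathbb{R}^3$ which is a 3-manifold, possibly with boundary; an edge is internal if it does not lie in the boundary. It is Delaunay if the open circumscribed ball of every tetrahedron contains no vertex of the triangulation, and non-degenerate if moreover, for any two tetrahedra sharing a triangle, the vertex of one not in the shared triangle lies strictly outside the circumsphere of the other. Simplices are non-degenerate; $c_\sigma$ denotes the circumcenter of a simplex $\sigma$ (taken in the affine hull of $\sigma$); $\prec$ means "is a face of". Dual of an internal edge $\tau$: $\star\tau$ is the polygon whose vertices are the circumcenters of the tetrahedra incident to $\tau$, taken in the cyclic order of these tetrahedra around $\tau$; its boundary edges join the circumcenters of the pairs of tetrahedra sharing a triangle incident to $\tau$. Signed area of $\star\tau$: for each chain $\tau\prec\sigma^2\prec\sigma^3$ with $\sigma^2$ a triangle and $\sigma^3$ a tetrahedron of the mesh, the elementary dual simplex is the (possibly degenerate) triangle with vertices $c_\tau,c_{\sigma^2},c_{\sigma^3}$. Its sign is $s=s_1 s_2$, where for $i=1,2$ (with $\sigma^1=\tau$) $s_i=+1$ if, in the affine hull of $\sigma^{i+1}$, the circumcenter $c_{\sigma^{i+1}}$ lies in the same half space relative to the affine hull of $\sigma^i$ as the vertex of $\sigma^{i+1}$ not in $\sigma^i$, and $s_i=-1$ otherwise. The signed area of $\star\tau$ is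 the sum, over all such chains, of $s$ times the (unsigned) area of the elementary dual simplex. *)

theory Defs
  imports "HOL-Analysis.Analysis"
begin

section \<open>Topological 3-manifolds with boundary\<close>

definition half_space3 :: "(real^3) set" where
  "half_space3 = {x. 0 \<le> x $ 3}"

text \<open>Hausdorffness and second countability are automatic for subspaces of a Euclidean space.\<close>

definition three_manifold_with_boundary :: "'a::euclidean_space set \<Rightarrow> bool" where
  "three_manifold_with_boundary X \<longleftrightarrow>
     (\<forall>x\<in>X. \<exists>U V. openin (top_of_set X) U \<and> x \<in> U \<and>
        openin (top_of_set half_space3) V \<and> U homeomorphic V)"

definition manifold_boundary :: "'a::euclidean_space set \<Rightarrow> 'a set" where
  "manifold_boundary X =
     {x \<in> X. \<not> (\<exists>U V. openin (top_of_set X) U \<and> x \<in> U \<and>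
        open (V :: (real^3) set) \<and> U homeomorphic V)}"

section \<open>Circumcenters\<close>

definition circumcenter :: "'a::euclidean_space set \<Rightarrow> 'a" where
  "circumcenter \<sigma> =
     (THE c. c \<in> affine hull \<sigma> \<and> (\<exists>r. \<forall>v. v extreme_point_of \<sigma> \<longrightarrow> dist c v = r))"

definition circumradius :: "'a::euclidean_space set \<Rightarrow> real" where
  "circumradius \<sigma> = (THE r. \<forall>v. v extreme_point_of \<sigma> \<longrightarrow> dist (circumcenter \<sigma>) v = r)"

section \<open>Tetrahedral Delaunay triangulations\<close>

text \<open>
  In \<^const>\<open>simplicial_complex\<close> simplices are convex hulls of affinely independent sets and
  intersect in common faces, so a complex is embedded by construction. The empty face is a
  member of any nonempty complex.
\<close>

definition tetrahedral_triangulation :: "(real^3) set set \<Rightarrow> bool" where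
  "tetrahedral_triangulation K \<longleftrightarrow>
     simplicial_complex K \<and> (\<exists>\<sigma>\<in>K. 3 simplex \<sigma>) \<and> three_manifold_with_boundary (\<Union>K)"

definition internal_edge :: "(real^3) set set \<Rightarrow> (real^3) set \<Rightarrow> bool" where
  "internal_edge K \<tau> \<longleftrightarrow> \<tau> \<in> K \<and> 1 simplex \<tau> \<and> \<not> \<tau> \<subseteq> manifold_boundary (\<Union>K)"

definition delaunay :: "(real^3) set set \<Rightarrow> bool" where
  "delaunay K \<longleftrightarrow>
     (\<forall>\<sigma>\<in>K. 3 simplex \<sigma> \<longrightarrow> (\<forall>v. {v} \<in> K \<longrightarrow> v \<notin> ball (circumcenter \<sigma>) (circumradius \<sigma>)))"

definition nondegenerate_delaunay :: "(real^3) set set \<Rightarrow> bool" where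
  "nondegenerate_delaunay K \<longleftrightarrow>
     delaunay K \<and>
     (\<forall>\<sigma>\<in>K. \<forall>\<sigma>'\<in>K. 3 simplex \<sigma> \<and> 3 simplex \<sigma>' \<and> 2 simplex (\<sigma> \<inter> \<sigma>') \<longrightarrow>
        (\<forall>v. v extreme_point_of \<sigma>' \<and> v \<notin> \<sigma> \<inter> \<sigma>' \<longrightarrow>
           circumradius \<sigma> < dist (circumcenter \<sigma>) v))"

section \<open>Polygons\<close>

text \<open>A polygon is the cyclic list of its vertices.\<close>

definition polygon_side :: "'a::euclidean_space list \<Rightarrow> nat \<Rightarrow> 'a set" where
  "polygon_side ps i = closed_segment (ps ! i) (ps ! (Suc i mod length ps))"

definition polygon_boundary :: "'a::euclidean_space list \<Rightarrow> 'a set" where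
  "polygon_boundary ps = (\<Union>i<length ps. polygon_side ps i)"

text \<open>Two distinct sides meet exactly in their common vertex, if they are consecutive, and
  are disjoint otherwise.\<close>

definition simple_polygon :: "'a::euclidean_space list \<Rightarrow> bool" where
  "simple_polygon ps \<longleftrightarrow>
     3 \<le> length ps \<and> distinct ps \<and>
     (\<forall>i<length ps. \<forall>j<length ps. i \<noteq> j \<longrightarrow>
        polygon_side ps i \<inter> polygon_side ps j =
          (if j = Suc i mod length ps then {ps ! j}
           else if i = Suc j mod length ps then {ps ! i} else {}))"

text \<open>The polygon bounds a convex planar region.\<close>

definition convex_polygon :: "'a::euclidean_space list \<Rightarrow> bool" where
  "convex_polygon ps \<longleftrightarrow>
     (\<exists>C. compact C \<and> convex C \<and> aff_dim C = 2 \<and> polygon_boundary ps = rel_frontier C)"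

section \<open>The circumcentric dual of an edge and its signed area\<close>

text \<open>
  The tetrahedra around an edge in cyclic order: each one shares with its successor a triangle
  that contains the edge. For an internal edge this determines the list up to rotation and
  reversal, because a triangle is a face of at most two tetrahedra.
\<close>

definition cyclic_order_around ::
    "(real^3) set set \<Rightarrow> (real^3) set \<Rightarrow> (real^3) set list \<Rightarrow> bool" where
  "cyclic_order_around K \<tau> ts \<longleftrightarrow>
     distinct ts \<and> set ts = {\<sigma>\<in>K. 3 simplex \<sigma> \<and> \<tau> face_of \<sigma>} \<and>
     (\<forall>i<length ts. let f = ts ! i \<inter> ts ! (Suc i mod length ts) in 2 simplex f \<and> \<tau> face_of f)"

definition circumcentric_dual ::
    "(real^3) set set \<Rightarrow> (real^3) set \<Rightarrow> (real^3) list \<Rightarrow> bool" where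
  "circumcentric_dual K \<tau> ps \<longleftrightarrow>
     (\<exists>ts. cyclic_order_around K \<tau> ts \<and> ps = map circumcenter ts)"

text \<open>
  Points \<open>x\<close> and \<open>y\<close> of \<open>affine hull S\<close> lie in the same one of the two open half spaces into which
  \<open>affine hull F\<close> divides it, where \<open>F\<close> is a facet of \<open>S\<close>.
\<close>

definition same_half_space ::
    "'a::euclidean_space set \<Rightarrow> 'a set \<Rightarrow> 'a \<Rightarrow> 'a \<Rightarrow> bool" where
  "same_half_space F S x y \<longleftrightarrow>
     (\<exists>a b. affine hull F = affine hull S \<inter> {z. a \<bullet> z = b} \<and> b < a \<bullet> x \<and> b < a \<bullet> y)"

text \<open>
  If the circumcenter of \<open>S\<close> lies on \<open>affine hull F\<close>, it equals the circumcenter of \<open>F\<close>, so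
  the elementary dual simplex has area zero and the choice of sign is immaterial.
\<close>

definition facet_sign :: "'a::euclidean_space set \<Rightarrow> 'a set \<Rightarrow> real" where
  "facet_sign F S =
     (if \<exists>v. v extreme_point_of S \<and> v \<notin> F \<and> same_half_space F S (circumcenter S) v
      then 1 else -1)"

definition triangle_area :: "real^3 \<Rightarrow> real^3 \<Rightarrow> real^3 \<Rightarrow> real" where
  "triangle_area a b c = norm (cross3 (b - a) (c - a)) / 2"

definition signed_dual_area :: "(real^3) set set \<Rightarrow> (real^3) set \<Rightarrow> real" where
  "signed_dual_area K \<tau> =
     (\<Sum>(f, \<sigma>) \<in> {(f, \<sigma>). f \<in> K \<and> \<sigma> \<in> K \<and> 2 simplex f \<and> 3 simplex \<sigma> \<and>
                        \<tau> face_of f \<and> f face_of \<sigma>}.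
        facet_sign \<tau> f * facet_sign f \<sigma> *
        triangle_area (circumcenter \<tau>) (circumcenter f) (circumcenter \<sigma>))"

end

theory Submission
  imports Defs
begin

text \<open>
  Let \<open>\<tau> = [a, b]\<close> and project along \<open>\<tau>\<close>. The tetrahedra at \<open>\<tau>\<close> become planar cones, and their
  circumcenters lie in the plane bisecting \<open>\<tau>\<close>. For an apex \<open>u\<close> of a triangle at \<open>\<tau>\<close>, the points of this
  plane equidistant from \<open>a\<close> and \<open>u\<close> form a line normal to the projection of \<open>u\<close>; a circumcenter is
  the intersection of the lines of its two apices, and the Delaunay condition puts all circumcenters
  on one side of every line, strictly for the apices of adjacent tetrahedra. Hence consecutive
  circumcenters differ by a positive multiple of the rotated normal, and a linear functional that
  is maximal at a circumcenter among its two neighbours is a nonnegative combination of the two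
  normals there. Applied to the functional of a further apex this places the apex inside a
  tetrahedron, which a simplicial complex forbids: so no third line passes through a circumcenter,
  and the tetrahedra around \<open>\<tau>\<close> form a single cycle. The same cone property shows that the
  boundary of the convex hull of the circumcenters is the dual polygon.
\<close>

text \<open>The definitions provide no cyclic structure around \<open>\<tau>\<close>. Internality
  enters through a point of the open edge that is interior to the union of \<open>K\<close>: moving
  slightly off the edge, or off a triangle near that point, stays inside finitely many simplices, so
  every triangle at \<open>\<tau>\<close> has a tetrahedron on each side. This makes "next apex" a
  permutation of the apices, which a priori may have several cycles; the Delaunay inequalities
  replace an argument with angles or winding numbers. The area is not positive term by term: a
  circumcenter may lie outside its simplex, and the midpoint of \<open>\<tau>\<close> outside the
  polygon. The sign convention makes the elementary areas add up to a shoelace sum, whose value does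
  not depend on the base point because the polygon is closed.\<close>

lemma convex_hull_Int_supporting_hyperplane:
  fixes S :: "'a::euclidean_space set"
  assumes "finite S" and x: "x \<in> convex hull S" and le: "\<And>y. y \<in> S \<Longrightarrow> w \<bullet> y \<le> \<gamma>" and eq: "w \<bullet> x = \<gamma>"
  shows "x \<in> convex hull {y \<in> S. w \<bullet> y = \<gamma>}"
proof -
  obtain u where u: "\<And>y. y \<in> S \<Longrightarrow> 0 \<le> u y" "sum u S = 1" "(\<Sum>y\<in>S. u y *\<^sub>R y) = x"
    using x \<open>finite S\<close> by (auto simp: convex_hull_finite)
  \<comment> \<open>The total slack of the convex combination is zero and every summand is
    nonnegative, so points off the hyperplane have weight zero.\<close>
  have "(\<Sum>y\<in>S. u y * (\<gamma> - w \<bullet> y)) = \<gamma> * sum u S - w \<bullet> (\<Sum>y\<in>S. u y *\<^sub>R y)"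
    by (simp add: right_diff_distrib sum_subtractf inner_sum_right sum_distrib_left mult.commute)
  also have "\<dots> = 0" using u eq by simp
  finally have "\<forall>y\<in>S. u y * (\<gamma> - w \<bullet> y) = 0"
    using \<open>finite S\<close> u(1) le by (subst (asm) sum_nonneg_eq_0_iff) auto
  then have z: "u y = 0" if "y \<in> S - {y \<in> S. w \<bullet> y = \<gamma>}" for y
    using that by auto
  let ?T = "{y \<in> S. w \<bullet> y = \<gamma>}"
  have "sum u ?T = 1" "(\<Sum>y\<in>?T. u y *\<^sub>R y) = x"
    using u(2,3) z \<open>finite S\<close>
    by (metis (mono_tags, lifting) mem_Collect_eq subsetI sum.mono_neutral_left)
      (use u(3) z \<open>finite S\<close> in \<open>subst sum.mono_neutral_left[where T=S]; force\<close>)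
  then show ?thesis
    using u(1) \<open>finite S\<close> by (subst convex_hull_finite) (auto intro!: exI[of _ u])
qed

lemma periodic_mod:
  fixes f :: "nat \<Rightarrow> 'b"
  assumes "\<And>i. f (i + N) = f i"
  shows "f (i mod N) = f i"
proof -
  have "f (i + k * N) = f i" for k i
    by (induction k) (auto simp: assms add.assoc[symmetric] add.commute[of N])
  then show ?thesis by (metis mod_div_mult_eq)
qed

lemma Suc_Suc_mod_neq: "3 \<le> n \<Longrightarrow> Suc (Suc i) mod n \<noteq> i mod n"
  by (auto simp: mod_Suc split: if_splits)

section \<open>Convex polygons described by supporting lines\<close>

text \<open>\<open>h i\<close> is an outer normal of the line carrying the side from
  \<open>c i\<close> to \<open>c (Suc i)\<close>. Indexing by all naturals with period
  \<open>N\<close> lets neighbours be named without reduction modulo \<open>N\<close>.\<close>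

locale supported_polygon =
  fixes N :: nat and c h :: "nat \<Rightarrow> 'a::euclidean_space" and \<beta> :: "nat \<Rightarrow> real"
  assumes N: "3 \<le> N"
    and per: "c (i + N) = c i"
    and inj: "inj_on c {..<N}"
    and le: "h i \<bullet> c j \<le> \<beta> i"
    and tight_iff: "h i \<bullet> c j = \<beta> i \<longleftrightarrow> c j = c i \<or> c j = c (Suc i)"
begin

lemma c_mod: "c (i mod N) = c i"
  by (rule periodic_mod[of c, OF per])

lemma c_eq_iff: "c i = c j \<longleftrightarrow> i mod N = j mod N"
  using N inj c_mod[of i] c_mod[of j]
  by (metis inj_on_eq_iff lessThan_iff mod_less_divisor not_gr_zero not_numeral_le_zero)

abbreviation "ps \<equiv> map c [0..<N]"

lemma polygon_side_ps:
  assumes "i < N"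
  shows "polygon_side ps i = closed_segment (c i) (c (Suc i))"
proof -
  have "Suc i mod N < N" using N by simp
  then show ?thesis
    using assms c_mod[of "Suc i"] by (simp add: polygon_side_def)
qed

lemma c_Suc_neq: "c (Suc i) \<noteq> c i"
  using N by (auto simp: c_eq_iff mod_Suc)

lemma c_Suc_Suc_neq: "c (Suc (Suc i)) \<noteq> c i"
  using N by (auto simp: c_eq_iff mod_Suc split: if_splits)

text \<open>A bound attained strictly inside a segment is attained at both ends. Line
  \<open>i\<close> contains no vertices besides the ends of side \<open>i\<close>, so the two sides
  would coincide.\<close>

lemma tight_ends:
  assumes "z \<in> closed_segment (c j) (c (Suc j))" "h i \<bullet> z = \<beta> i" "i mod N \<noteq> j mod N"
  shows "z = c j \<or> z = c (Suc j)"
proof (rule ccontr)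
  assume neg: "\<not> ?thesis"
  obtain u where u: "0 \<le> u" "u \<le> 1" "z = (1 - u) *\<^sub>R c j + u *\<^sub>R c (Suc j)"
    using assms(1) by (auto simp: closed_segment_def)
  have u1: "u \<noteq> 0" "u \<noteq> 1" using neg u by auto
  have "(1 - u) * (\<beta> i - h i \<bullet> c j) + u * (\<beta> i - h i \<bullet> c (Suc j)) = 0"
    using assms(2) u(3) by (simp add: inner_add_right algebra_simps)
  moreover have "0 \<le> (1 - u) * (\<beta> i - h i \<bullet> c j)" "0 \<le> u * (\<beta> i - h i \<bullet> c (Suc j))"
    using u le by auto
  ultimately have "(1 - u) * (\<beta> i - h i \<bullet> c j) = 0" "u * (\<beta> i - h i \<bullet> c (Suc j)) = 0"
    by linarith+
  with u1 have "h i \<bullet> c j = \<beta> i" "h i \<bullet> c (Suc j) = \<beta> i" by auto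
  then show False
    using tight_iff[of i j] tight_iff[of i "Suc j"] c_Suc_neq[of j] c_Suc_neq[of i] c_Suc_Suc_neq[of i] assms(3)
      c_eq_iff[of j "Suc i"] c_eq_iff[of "Suc j" "Suc (Suc i)"] c_eq_iff[of i j] mod_Suc_eq[of j N]
    by (metis mod_Suc_eq)
qed

lemma tight_segment:
  assumes "z \<in> closed_segment (c i) (c (Suc i))"
  shows "h i \<bullet> z = \<beta> i"
proof -
  have "h i \<bullet> c i = \<beta> i" "h i \<bullet> c (Suc i) = \<beta> i" using tight_iff by auto
  then have "closed_segment (c i) (c (Suc i)) \<subseteq> {z. h i \<bullet> z = \<beta> i}"
    by (intro closed_segment_subset) (auto intro: convex_hyperplane)
  then show ?thesis using assms by auto
qed

text \<open>A common point of two sides lies on both supporting lines, so by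
  \<open>tight_ends\<close> it is an end of each; the rest compares indices.\<close>

lemma side_Int_side:
  assumes ij: "i < N" "j < N" "i \<noteq> j"
  shows "closed_segment (c i) (c (Suc i)) \<inter> closed_segment (c j) (c (Suc j)) =
     (if j = Suc i mod N then {c j} else if i = Suc j mod N then {c i} else {})"
    (is "?A \<inter> ?B = ?R")
proof
  show "?A \<inter> ?B \<subseteq> ?R"
  proof
    fix z assume z: "z \<in> ?A \<inter> ?B"
    have 1: "z = c j \<or> z = c (Suc j)"
      using z ij by (intro tight_ends[of _ _ i]) (auto intro: tight_segment)
    have 2: "z = c i \<or> z = c (Suc i)"
      using z ij by (intro tight_ends[of _ _ j]) (auto intro: tight_segment)
    have "c i \<noteq> c j" "c (Suc i) \<noteq> c (Suc j)"
      using ij by (auto simp: c_eq_iff mod_Suc split: if_splits)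
    with 1 2 have "z = c j \<and> c j = c (Suc i) \<or> z = c i \<and> c i = c (Suc j)" by auto
    then have "z = c j \<and> j = Suc i mod N \<or> z = c i \<and> i = Suc j mod N"
      using ij by (auto simp: c_eq_iff)
    moreover have "\<not> (j = Suc i mod N \<and> i = Suc j mod N)"
      using ij N by (auto simp: mod_Suc split: if_splits)
    ultimately show "z \<in> ?R" by auto
  qed
  show "?R \<subseteq> ?A \<inter> ?B"
    using c_mod[of "Suc i"] c_mod[of "Suc j"] by auto
qed

lemma simple_polygon_ps: "simple_polygon ps"
  using N inj side_Int_side
  by (simp add: simple_polygon_def polygon_side_ps distinct_map atLeast0LessThan)

lemma polygon_boundary_ps: "polygon_boundary ps = (\<Union>i. closed_segment (c i) (c (Suc i)))"
proof -
  have "closed_segment (c (i mod N)) (c (Suc (i mod N))) = closed_segment (c i) (c (Suc i))" for i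
    using c_mod by (metis mod_Suc_eq)
  moreover have "i mod N < N" for i using N by simp
  ultimately show ?thesis
    by (fastforce simp: polygon_boundary_def polygon_side_ps)
qed

text \<open>Gives every vertex a predecessor, so that the hypothesis \<open>cone\<close> below,
  which speaks of \<open>c (Suc i)\<close>, applies at all of them.\<close>

lemma ex_Suc: "\<exists>i. c k = c (Suc i)"
  using per[of k] N by (metis add_Suc_right less_imp_Suc_add less_le_trans zero_less_numeral)

lemma finite_range_c: "finite (range c)"
proof -
  have "range c \<subseteq> c ` {..<N}"
    using c_mod N by (metis image_eqI image_subsetI lessThan_iff mod_less_divisor not_gr_zero not_numeral_le_zero)
  then show ?thesis by (rule finite_subset) simp
qed

text \<open>
  The hypothesis \<open>cone\<close> says that a linear functional that is maximal at a vertex among its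
  neighbours is a nonnegative combination of the normals of the two sides meeting there.
\<close>

lemma convex_polygon_ps:
  assumes cone: "\<And>w i. w \<bullet> c i \<le> w \<bullet> c (Suc i) \<Longrightarrow> w \<bullet> c (Suc (Suc i)) \<le> w \<bullet> c (Suc i) \<Longrightarrow>
      \<exists>x\<ge>0. \<exists>y\<ge>0. \<forall>k. w \<bullet> (c k - c (Suc i)) =
        x * (h i \<bullet> (c k - c (Suc i))) + y * (h (Suc i) \<bullet> (c k - c (Suc i)))"
    and dim: "aff_dim (range c) \<le> 2"
  shows "convex_polygon ps"
proof -
  define C where "C = convex hull (range c)"
  have cC: "c i \<in> C" for i unfolding C_def by (rule hull_inc) auto
  have leC: "h i \<bullet> z \<le> \<beta> i" if "z \<in> C" for z i
  proof -
    have "C \<subseteq> {z. h i \<bullet> z \<le> \<beta> i}"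
      unfolding C_def using le by (intro hull_minimal) (auto intro: convex_halfspace_le)
    then show ?thesis using that by auto
  qed
  have convC: "convex C" by (simp add: C_def)
  have F: "(C \<inter> {z. h i \<bullet> z = \<beta> i}) face_of C" for i
    using convC leC by (rule face_of_Int_supporting_hyperplane_le)
  have Fne: "C \<inter> {z. h i \<bullet> z = \<beta> i} \<noteq> C" for i
    using cC[of "Suc (Suc i)"] tight_iff[of i "Suc (Suc i)"] c_Suc_neq[of "Suc i"] c_Suc_Suc_neq[of i]
    by auto
  have comp: "compact C"
    unfolding C_def using finite_range_c by (simp add: finite_imp_compact_convex_hull)
  have "aff_dim C = 2"
  proof -
    \<comment> \<open>A side spans a line and lies in a proper face of \<open>C\<close>, so the
      dimension exceeds 1.\<close>
    have "aff_dim {c 0, c (Suc 0)} \<le> aff_dim (C \<inter> {z. h 0 \<bullet> z = \<beta> 0})"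
      using cC tight_iff by (intro aff_dim_subset) auto
    moreover have "aff_dim {c 0, c (Suc 0)} = 1"
      using c_Suc_neq[of 0] by (simp add: aff_dim_2)
    moreover have "aff_dim (C \<inter> {z. h 0 \<bullet> z = \<beta> 0}) < aff_dim C"
      using face_of_aff_dim_lt[OF convC F Fne] .
    moreover have "aff_dim C \<le> 2" using dim by (simp add: C_def aff_dim_convex_hull)
    ultimately show ?thesis by linarith
  qed
  moreover have "polygon_boundary ps = rel_frontier C"
  proof
    show "polygon_boundary ps \<subseteq> rel_frontier C"
    proof
      fix z assume "z \<in> polygon_boundary ps"
      then obtain i where i: "z \<in> closed_segment (c i) (c (Suc i))"
        by (auto simp: polygon_boundary_ps)
      then have "z \<in> C" using cC closed_segment_subset[OF _ _ convC] by blast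
      moreover have "z \<notin> rel_interior C"
        using face_of_disjoint_rel_interior[OF F Fne, of i] tight_segment[OF i] \<open>z \<in> C\<close> by blast
      ultimately show "z \<in> rel_frontier C"
        using closure_subset by (auto simp: rel_frontier_def)
    qed
    show "rel_frontier C \<subseteq> polygon_boundary ps"
    proof
      fix z assume "z \<in> rel_frontier C"
      then have z: "z \<in> C" "z \<notin> rel_interior C"
        using comp by (auto simp: rel_frontier_def compact_imp_closed)
      obtain a where a: "\<And>y. y \<in> C \<Longrightarrow> a \<bullet> z \<le> a \<bullet> y" "\<And>y. y \<in> rel_interior C \<Longrightarrow> a \<bullet> z < a \<bullet> y"
        using supporting_hyperplane_rel_boundary[OF convC z] by metis
      \<comment> \<open>The sign is changed so that \<open>z\<close> maximizes \<open>w\<close> on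
        \<open>C\<close>; hence \<open>z\<close> is a convex combination of maximizing
        vertices.\<close>
      define w where "w = - a"
      have wle: "w \<bullet> y \<le> w \<bullet> z" if "y \<in> C" for y using a(1) that by (simp add: w_def)
      have zT: "z \<in> convex hull {y \<in> range c. w \<bullet> y = w \<bullet> z}"
        using z(1) cC wle finite_range_c unfolding C_def
        by (intro convex_hull_Int_supporting_hyperplane) auto
      then have "{y \<in> range c. w \<bullet> y = w \<bullet> z} \<noteq> {}" by force
      then obtain k where k: "w \<bullet> c k = w \<bullet> z" by auto
      then obtain i where i: "w \<bullet> c (Suc i) = w \<bullet> z" using ex_Suc by metis
      then obtain x y where xy: "0 \<le> x" "0 \<le> y"
        "\<And>k. w \<bullet> (c k - c (Suc i)) = x * (h i \<bullet> (c k - c (Suc i))) + y * (h (Suc i) \<bullet> (c k - c (Suc i)))"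
        using cone[of w i] cC wle by auto
      have t: "h i \<bullet> c (Suc i) = \<beta> i" "h (Suc i) \<bullet> c (Suc i) = \<beta> (Suc i)"
        using tight_iff by auto
      \<comment> \<open>The slack of \<open>w\<close> is a nonnegative combination of the slacks of
        the two lines, so a maximizing vertex lies on each line whose coefficient is
        positive.\<close>
      have tk: "x * (\<beta> i - h i \<bullet> c k) = 0 \<and> y * (\<beta> (Suc i) - h (Suc i) \<bullet> c k) = 0"
        if "w \<bullet> c k = w \<bullet> z" for k
      proof -
        have "x * (\<beta> i - h i \<bullet> c k) + y * (\<beta> (Suc i) - h (Suc i) \<bullet> c k) = 0"
          using xy(3)[of k] that i t by (simp add: inner_diff_right algebra_simps)
        moreover have "0 \<le> x * (\<beta> i - h i \<bullet> c k)" "0 \<le> y * (\<beta> (Suc i) - h (Suc i) \<bullet> c k)"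
          using xy le by auto
        ultimately show ?thesis by linarith
      qed
      have side: "z \<in> polygon_boundary ps"
        if "\<And>k. w \<bullet> c k = w \<bullet> z \<Longrightarrow> h j \<bullet> c k = \<beta> j" for j
      proof -
        have "{y \<in> range c. w \<bullet> y = w \<bullet> z} \<subseteq> {c j, c (Suc j)}"
          using that tight_iff by auto
        then have "z \<in> convex hull {c j, c (Suc j)}"
          using zT hull_mono by blast
        then show ?thesis by (auto simp: polygon_boundary_ps segment_convex_hull)
      qed
      consider "x > 0" | "y > 0" | "x = 0" "y = 0" using xy by linarith
      then show "z \<in> polygon_boundary ps"
      proof cases
        case 1 then show ?thesis using tk by (intro side[of i]) force
      next
        case 2 then show ?thesis using tk by (intro side[of "Suc i"]) force
      next
        case 3
        have "w \<bullet> c k = w \<bullet> z" for k using xy(3)[of k] 3 i by (simp add: inner_diff_right)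
        then have "C \<subseteq> {y. w \<bullet> y = w \<bullet> z}"
          unfolding C_def by (intro hull_minimal) (auto intro: convex_hyperplane)
        moreover obtain y where "y \<in> rel_interior C"
          using convC cC by (metis empty_iff rel_interior_eq_empty equals0I)
        ultimately show ?thesis
          using a(2) rel_interior_subset by (fastforce simp: w_def)
      qed
    qed
  qed
  ultimately show ?thesis using comp convC unfolding convex_polygon_def by blast
qed

end

section \<open>Simplicial complexes\<close>

text \<open>Simplices are handled through their vertex sets, which turns faces and intersections
  into inclusions and intersections of finite sets.\<close>

definition spans_simplex :: "'a::euclidean_space set set \<Rightarrow> 'a set \<Rightarrow> bool" where
  "spans_simplex K A \<longleftrightarrow> \<not> affine_dependent A \<and> convex hull A \<in> K"

text \<open>Points of \<open>B\<close> are extreme in the hull of \<open>A\<close>, hence in the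
  smaller hull of \<open>C\<close>, and extreme points of a hull belong to its generating
  set.\<close>

lemma convex_hull_subset_aff_independent:
  fixes A B :: "'a::euclidean_space set"
  assumes "\<not> affine_dependent A" "B \<subseteq> A" "C \<subseteq> A" "convex hull B \<subseteq> convex hull C"
  shows "B \<subseteq> C"
proof
  fix x assume x: "x \<in> B"
  have "x extreme_point_of convex hull A"
    using x assms extreme_point_of_convex_hull_affine_independent by blast
  moreover have "x \<in> convex hull C" using hull_inc[OF x] assms(4) by blast
  moreover have "convex hull C \<subseteq> convex hull A" using assms(3) by (rule hull_mono)
  ultimately have "x extreme_point_of convex hull C"
    unfolding extreme_point_of_def by blast
  then show "x \<in> C" by (rule extreme_point_of_convex_hull)
qed

lemma spans_simplex_mono:
  assumes "simplicial_complex K" "spans_simplex K A" "B \<subseteq> A"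
  shows "spans_simplex K B"
  using assms affine_independent_subset[of A B] face_of_convex_hull_affine_independent[of A "convex hull B"]
  unfolding spans_simplex_def simplicial_complex_def by blast

text \<open>The intersection is a common face, so it is the hull of a subset of \<open>A\<close> and
  of a subset of \<open>B\<close>. Both subsets consist of its extreme points and hence
  coincide.\<close>

lemma convex_hull_Int_simplicial_complex:
  assumes K: "simplicial_complex K" and A: "spans_simplex K A" and B: "spans_simplex K B"
  shows "convex hull A \<inter> convex hull B = convex hull (A \<inter> B)"
proof
  have "(convex hull A \<inter> convex hull B) face_of convex hull A"
    "(convex hull B \<inter> convex hull A) face_of convex hull B"
    using K A B unfolding simplicial_complex_def spans_simplex_def by auto
  then obtain C D where C: "C \<subseteq> A" "convex hull A \<inter> convex hull B = convex hull C"
    and D: "D \<subseteq> B" "convex hull A \<inter> convex hull B = convex hull D"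
    using A B unfolding spans_simplex_def
    by (metis face_of_convex_hull_affine_independent inf_commute)
  have "\<not> affine_dependent C" "\<not> affine_dependent D"
    using A B C(1) D(1) affine_independent_subset unfolding spans_simplex_def by blast+
  then have "C = D"
    using C(2) D(2) extreme_point_of_convex_hull_affine_independent by (metis set_eqI)
  then show "convex hull A \<inter> convex hull B \<subseteq> convex hull (A \<inter> B)"
    using C D by (metis hull_mono le_inf_iff)
qed (simp add: hull_mono)

lemma spans_simplex_subset_iff:
  assumes K: "simplicial_complex K" and A: "spans_simplex K A" and B: "spans_simplex K B"
  shows "convex hull A \<subseteq> convex hull B \<longleftrightarrow> A \<subseteq> B"
proof
  assume "convex hull A \<subseteq> convex hull B"
  then have "convex hull A \<subseteq> convex hull (A \<inter> B)"
    using convex_hull_Int_simplicial_complex[OF assms] by auto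
  then have "A \<subseteq> A \<inter> B"
    using A convex_hull_subset_aff_independent[of A A "A \<inter> B"] unfolding spans_simplex_def by simp
  then show "A \<subseteq> B" by simp
qed (rule hull_mono)

lemma spans_simplex_eq_iff:
  assumes K: "simplicial_complex K" and A: "spans_simplex K A" and B: "spans_simplex K B"
  shows "convex hull A = convex hull B \<longleftrightarrow> A = B"
  using spans_simplex_subset_iff assms by blast

lemma spans_simplex_face_iff:
  assumes K: "simplicial_complex K" and A: "spans_simplex K A" and B: "spans_simplex K B"
  shows "convex hull A face_of convex hull B \<longleftrightarrow> A \<subseteq> B"
  using spans_simplex_subset_iff[OF assms] B face_of_imp_subset[of "convex hull A" "convex hull B"]
    face_of_convex_hull_affine_independent[of B "convex hull A"]
  unfolding spans_simplex_def by blast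

text \<open>A face that meets the relative interior of a convex set is the whole set; here the face
  is the intersection of the two simplices.\<close>

lemma spans_simplex_rel_interior_subset:
  assumes K: "simplicial_complex K" and A: "spans_simplex K A" and B: "spans_simplex K B"
    and "x \<in> rel_interior (convex hull A)" "x \<in> convex hull B"
  shows "A \<subseteq> B"
proof -
  have "convex hull A \<inter> convex hull B face_of convex hull A"
    using K A B unfolding simplicial_complex_def spans_simplex_def by auto
  moreover have "x \<in> (convex hull A \<inter> convex hull B) \<inter> rel_interior (convex hull A)"
    using assms rel_interior_subset by blast
  ultimately have "convex hull A \<inter> convex hull B = convex hull A"
    using face_of_disjoint_rel_interior by blast
  then show ?thesis using spans_simplex_subset_iff[OF K A B] by blast
qed

lemma simplicial_complex_obtains:
  assumes "simplicial_complex K" "S \<in> K"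
  obtains A where "spans_simplex K A" "S = convex hull A"
proof -
  obtain n where "n simplex S" using assms unfolding simplicial_complex_def by blast
  then show ?thesis using that assms(2) unfolding simplex_def spans_simplex_def by blast
qed

lemma spans_simplex_simplex_iff:
  assumes "spans_simplex K A"
  shows "n simplex (convex hull A) \<longleftrightarrow> int (card A) = n + 1"
proof -
  have "C = A" if "\<not> affine_dependent C" "convex hull A = convex hull C" for C
    using assms that extreme_point_of_convex_hull_affine_independent
    unfolding spans_simplex_def by (metis set_eqI)
  then show ?thesis
    using assms unfolding simplex_def spans_simplex_def by blast
qed

text \<open>
  One of the finitely many simplices contains infinitely many points of a sequence approaching
  \<open>q\<close> from direction \<open>e\<close>, hence also \<open>q\<close> itself.
\<close>

lemma simplicial_complex_direction:
  fixes e :: "'a::euclidean_space"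
  assumes K: "simplicial_complex K" and A: "spans_simplex K A"
    and q: "q \<in> rel_interior (convex hull A)" "q \<in> interior (\<Union>K)"
  obtains B s where "spans_simplex K B" "A \<subseteq> B" "0 < s" "q + s *\<^sub>R e \<in> convex hull B"
proof -
  let ?x = "\<lambda>k. q + (1 / real (Suc k)) *\<^sub>R e"
  have lim: "?x \<longlonglongrightarrow> q"
    using tendsto_add[OF tendsto_const tendsto_scaleR[OF LIMSEQ_inverse_real_of_nat tendsto_const], of q e]
    by (simp add: inverse_eq_divide)
  then have "eventually (\<lambda>k. ?x k \<in> interior (\<Union>K)) sequentially"
    using q(2) by (rule topological_tendstoD[OF _ open_interior])
  then obtain k0 where k0: "\<And>k. k \<ge> k0 \<Longrightarrow> ?x k \<in> \<Union>K"
    unfolding eventually_sequentially using interior_subset by blast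
  have "infinite {k0..}" by (rule infinite_Ici)
  moreover have "{k0..} \<subseteq> (\<Union>S\<in>K. {k. ?x k \<in> S})" using k0 by auto
  ultimately obtain S where S: "S \<in> K" "infinite {k. ?x k \<in> S}"
    using K unfolding simplicial_complex_def
      by (metis (no_types, lifting) finite_UN_I finite_subset)
  obtain B where B: "spans_simplex K B" "S = convex hull B"
    using simplicial_complex_obtains[OF K S(1)] .
  have "closed S" using B by (simp add: spans_simplex_def aff_independent_finite
        compact_imp_closed finite_imp_compact_convex_hull)
  moreover obtain r :: "nat \<Rightarrow> nat" where r: "strict_mono r" "\<And>k. ?x (r k) \<in> S"
    using infinite_enumerate[OF S(2)] by auto
  moreover have "(\<lambda>k. ?x (r k)) \<longlonglongrightarrow> q"
    using LIMSEQ_subseq_LIMSEQ[OF lim r(1)] by (simp add: o_def)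
  ultimately have "q \<in> S" using closed_sequentially[of S "\<lambda>k. ?x (r k)" q] by blast
  then have "A \<subseteq> B" using spans_simplex_rel_interior_subset[OF K A B(1) q(1)] B(2) by simp
  with B r(2)[of 0] show ?thesis by (intro that[of B "1 / real (Suc (r 0))"]) auto
qed

section \<open>Interior points, circumcenters and half spaces\<close>

lemma manifold_interior_point:
  fixes X :: "(real^3) set"
  assumes "x \<in> X" "x \<notin> manifold_boundary X"
  shows "x \<in> interior X"
proof -
  obtain U V where U: "openin (top_of_set X) U" "x \<in> U" and V: "open (V :: (real^3) set)" "U homeomorphic V"
    using assms unfolding manifold_boundary_def by blast
  obtain f g where "homeomorphism V U f g"
    using V(2) homeomorphic_sym unfolding homeomorphic_def by metis
  then have "continuous_on V f" "inj_on f V" "f ` V = U"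
    by (auto simp: homeomorphism_def intro: inj_on_inverseI)
  \<comment> \<open>Equal dimensions upgrade openness relative to \<open>X\<close> to openness in
    the whole space.\<close>
  then have "open U" using invariance_of_domain V(1) by metis
  then show ?thesis using U openin_imp_subset[OF U(1)] by (meson interior_maximal subsetD)
qed

text \<open>Resolves both definite descriptions. For two candidate centers \<open>c\<close> and
  \<open>c'\<close>, the inner product with \<open>c - c'\<close> is constant on the vertices, hence
  on the affine hull, which contains both; so \<open>c - c'\<close> is orthogonal to itself.\<close>

lemma circumcenter_convex_hull:
  fixes A :: "'a::euclidean_space set"
  assumes A: "\<not> affine_dependent A" "A \<noteq> {}" and c: "c \<in> affine hull A" "\<And>x. x \<in> A \<Longrightarrow> dist c x = r"
  shows "circumcenter (convex hull A) = c" and "circumradius (convex hull A) = r"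
proof -
  have ext: "v extreme_point_of convex hull A \<longleftrightarrow> v \<in> A" for v
    using A(1) by (rule extreme_point_of_convex_hull_affine_independent)
  show 1: "circumcenter (convex hull A) = c"
    unfolding circumcenter_def ext affine_hull_convex_hull
  proof (rule the_equality)
    fix c' assume "c' \<in> affine hull A \<and> (\<exists>r. \<forall>v. v \<in> A \<longrightarrow> dist c' v = r)"
    then obtain r' where c': "c' \<in> affine hull A" "\<And>v. v \<in> A \<Longrightarrow> dist c' v = r'" by blast
    define b where "b = (r'\<^sup>2 - r\<^sup>2 - (c' \<bullet> c' - c \<bullet> c)) / 2"
    have "(c - c') \<bullet> v = b" if "v \<in> A" for v
    proof -
      have "(dist c v)\<^sup>2 = r\<^sup>2" "(dist c' v)\<^sup>2 = r'\<^sup>2" using c(2) c'(2) that by auto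
      then show ?thesis
        by (simp add: b_def dist_norm power2_norm_eq_inner inner_diff inner_commute)
    qed
    then have "affine hull A \<subseteq> {v. (c - c') \<bullet> v = b}"
      by (intro hull_minimal) (auto intro: affine_hyperplane)
    then have "(c - c') \<bullet> c = b" "(c - c') \<bullet> c' = b" using c(1) c'(1) by auto
    then have "(c - c') \<bullet> (c - c') = 0" by (simp add: inner_diff_right)
    then show "c' = c" by simp
  qed (use c in auto)
  show "circumradius (convex hull A) = r"
    unfolding circumradius_def ext 1 using A(2) c(2) by (intro the_equality) auto
qed

text \<open>The definition leaves the functional free; any one that describes \<open>F\<close>
  decides. If it changed sign between \<open>x\<close> and \<open>y\<close>, the segment would meet
  the affine hull of \<open>F\<close>, where the other functional equals \<open>b'\<close>, although
  it exceeds \<open>b'\<close> on the whole segment.\<close>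

lemma same_half_space_iff:
  assumes F: "affine hull F = affine hull S \<inter> {z. a \<bullet> z = b}"
    and xy: "x \<in> affine hull S" "y \<in> affine hull S"
  shows "same_half_space F S x y \<longleftrightarrow> 0 < (a \<bullet> x - b) * (a \<bullet> y - b)"
proof
  assume "0 < (a \<bullet> x - b) * (a \<bullet> y - b)"
  then consider "b < a \<bullet> x" "b < a \<bullet> y" | "- b < (- a) \<bullet> x" "- b < (- a) \<bullet> y"
    by (auto simp: zero_less_mult_iff)
  then show "same_half_space F S x y"
  proof cases
    case 1 then show ?thesis using F unfolding same_half_space_def by blast
  next
    case 2
    moreover have "affine hull F = affine hull S \<inter> {z. (- a) \<bullet> z = - b}" using F by auto
    ultimately show ?thesis unfolding same_half_space_def by blast
  qed
next
  assume "same_half_space F S x y"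
  then obtain a' b' where a': "affine hull F = affine hull S \<inter> {z. a' \<bullet> z = b'}" "b' < a' \<bullet> x" "b' < a' \<bullet> y"
    unfolding same_half_space_def by blast
  have seg: "\<not> (\<exists>z\<in>closed_segment x y. a \<bullet> z = b)"
  proof
    assume "\<exists>z\<in>closed_segment x y. a \<bullet> z = b"
    then obtain z where z: "z \<in> closed_segment x y" "a \<bullet> z = b" by blast
    have "z \<in> affine hull S"
      using z(1) xy closed_segment_subset affine_imp_convex affine_affine_hull by blast
    then have "a' \<bullet> z = b'" using F a'(1) z(2) by blast
    moreover have "closed_segment x y \<subseteq> {z. b' < a' \<bullet> z}"
      using a' by (intro closed_segment_subset) (auto intro: convex_halfspace_gt)
    ultimately show False using z(1) by auto
  qed
  show "0 < (a \<bullet> x - b) * (a \<bullet> y - b)"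
  proof (rule ccontr)
    assume "\<not> ?thesis"
    then have "a \<bullet> x \<le> b \<and> b \<le> a \<bullet> y \<or> a \<bullet> y \<le> b \<and> b \<le> a \<bullet> x"
      by (auto simp: zero_less_mult_iff not_less)
    then show False
      using seg connected_ivt_hyperplane[OF convex_connected[OF convex_closed_segment], of x x y y a b]
        connected_ivt_hyperplane[OF convex_connected[OF convex_closed_segment], of y x y x a b]
          by auto
  qed
qed

section \<open>Points of simplices given by barycentric coordinates\<close>

lemma convex_hull_4_mem:
  fixes p q r s :: "'a::real_vector"
  assumes "0 \<le> x" "0 \<le> y" "0 \<le> z" "0 \<le> t" "x + y + z + t = 1"
  shows "x *\<^sub>R p + y *\<^sub>R q + z *\<^sub>R r + t *\<^sub>R s \<in> convex hull {p, q, r, s}"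
proof -
  have "(\<Sum>i\<in>{0,1,2,3::nat}. [x,y,z,t] ! i *\<^sub>R [p,q,r,s] ! i) \<in> convex hull {p, q, r, s}"
    by (rule convex_sum) (use assms in \<open>auto simp: hull_inc\<close>)
  then show ?thesis by (simp add: add.assoc)
qed

lemma rel_interior_triangle_mem:
  fixes p q r :: "'a::euclidean_space"
  assumes "\<not> affine_dependent {p, q, r}" "p \<noteq> q" "r \<notin> {p, q}"
    and "0 < x" "0 < y" "0 < z" "x + y + z = 1"
  shows "x *\<^sub>R p + y *\<^sub>R q + z *\<^sub>R r \<in> rel_interior (convex hull {p, q, r})"
  unfolding rel_interior_convex_hull_explicit[OF assms(1)]
  using assms(2-)
  by (auto intro!: exI[of _ "\<lambda>v. if v = p then x else if v = q then y else z"] simp: add.assoc)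

section \<open>Coordinates around an edge\<close>

text \<open>No orientation is imposed on \<open>e1\<close>, \<open>e2\<close>: the frame mirrored by
  \<open>- e2\<close> is again a frame, which later handles lists running the other way around the
  edge.\<close>

locale edge_frame =
  fixes a b e1 e2 :: "real^3"
  assumes ab: "a \<noteq> b"
    and e11: "e1 \<bullet> e1 = 1" and e22: "e2 \<bullet> e2 = 1" and e12: "e1 \<bullet> e2 = 0"
    and e1ab: "e1 \<bullet> (b - a) = 0" and e2ab: "e2 \<bullet> (b - a) = 0"
begin

definition "m = midpoint a b"
definition "px x = e1 \<bullet> (x - m)"
definition "py x = e2 \<bullet> (x - m)"
definition "pz x = (b - a) \<bullet> (x - m) / ((b - a) \<bullet> (b - a))"
definition "pt X Y = m + X *\<^sub>R e1 + Y *\<^sub>R e2"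
text \<open>The planar cross product of the projections along the edge. Its sign tells on which side
  of the plane through \<open>a\<close>, \<open>b\<close>, \<open>v\<close> the point
  \<open>w\<close> lies.\<close>

definition "turn v w = px v * py w - py v * px w"

lemma e21: "e2 \<bullet> e1 = 0" using e12 by (simp add: inner_commute)
lemma abe: "(b - a) \<bullet> e1 = 0" "(b - a) \<bullet> e2 = 0" using e1ab e2ab by (auto simp: inner_commute)
lemma abab: "(b - a) \<bullet> (b - a) \<noteq> 0" using ab by simp

lemma expand: "x - m = px x *\<^sub>R e1 + py x *\<^sub>R e2 + pz x *\<^sub>R (b - a)"
proof (rule ccontr)
  define r where "r = x - m - (px x *\<^sub>R e1 + py x *\<^sub>R e2 + pz x *\<^sub>R (b - a))"
  assume "\<not> ?thesis"
  then have r0: "r \<noteq> 0" by (auto simp: r_def)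
  have r: "e1 \<bullet> r = 0" "e2 \<bullet> r = 0" "(b - a) \<bullet> r = 0"
    using abab by (simp_all add: r_def inner_diff_right[of _ "x - m"] inner_add_right px_def py_def pz_def
        e11 e22 e12 e21 e1ab e2ab abe)
  have n0: "e1 \<noteq> 0" "e2 \<noteq> 0" "b - a \<noteq> 0" using e11 e22 ab by auto
  have ne: "e1 \<noteq> e2" "e1 \<noteq> b - a" "e2 \<noteq> b - a" "e1 \<noteq> r" "e2 \<noteq> r" "b - a \<noteq> r"
    using e12 e1ab e2ab r n0 by (metis inner_eq_zero_iff)+
  have "pairwise orthogonal {e1, e2, b - a, r}"
    using r e12 e21 e1ab e2ab abe by (auto simp: pairwise_def orthogonal_def inner_commute)
  then have "independent {e1, e2, b - a, r}"
    using n0 r0 by (intro pairwise_orthogonal_independent) auto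
  then have "card {e1, e2, b - a, r} \<le> DIM(real^3)"
    by (rule independent_card_le)
  then show False using ne by simp
qed

lemma px_affine: "px z = e1 \<bullet> z - e1 \<bullet> m" by (simp add: px_def inner_diff_right)
lemma py_affine: "py z = e2 \<bullet> z - e2 \<bullet> m" by (simp add: py_def inner_diff_right)

lemma a_minus_m: "a - m = (- 1 / 2) *\<^sub>R (b - a)"
  unfolding m_def midpoint_def by (simp add: algebra_simps flip: scaleR_add_left)
lemma b_minus_m: "b - m = (1 / 2) *\<^sub>R (b - a)"
  unfolding m_def midpoint_def by (simp add: algebra_simps flip: scaleR_add_left)

lemma coords_ends [simp]: "px a = 0" "py a = 0" "px b = 0" "py b = 0"
  unfolding px_def py_def a_minus_m b_minus_m by (simp_all add: e1ab e2ab)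

lemma coords_m [simp]: "px m = 0" "py m = 0" "pz m = 0" by (simp_all add: px_def py_def pz_def)

lemma coords_pt [simp]: "px (pt X Y) = X" "py (pt X Y) = Y" "pz (pt X Y) = 0"
  by (simp_all add: px_def py_def pz_def pt_def inner_add_right e11 e22 e12 e21 abe)

lemma inner_pt: "(pt X Y - m) \<bullet> (v - m) = X * px v + Y * py v"
  by (simp add: pt_def px_def py_def inner_add_left)

lemma inner_pt_diff: "w \<bullet> (pt X Y - pt X' Y') = (w \<bullet> e1) * (X - X') + (w \<bullet> e2) * (Y - Y')"
  by (simp add: pt_def algebra_simps)

text \<open>Half the power of \<open>v\<close> with respect to the sphere with diameter
  \<open>a\<close>, \<open>b\<close>. In the plane bisecting the edge,
  \<open>X * px v + Y * py v = bis v\<close> is the line of points equidistant from \<open>a\<close>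
  and \<open>v\<close>.\<close>

definition "bis v = ((v - m) \<bullet> (v - m) - (a - m) \<bullet> (a - m)) / 2"

text \<open>Linearizes the Delaunay condition: the terms quadratic in \<open>X\<close> and
  \<open>Y\<close> cancel in the difference of squared distances.\<close>

lemma dist_pt: "(dist (pt X Y) v)\<^sup>2 = (dist (pt X Y) a)\<^sup>2 + 2 * (bis v - (X * px v + Y * py v))"
proof -
  have sq: "(x - y) \<bullet> (x - y) = x \<bullet> x - 2 * (x \<bullet> y) + y \<bullet> y" for x y :: "real^3"
    by (simp add: inner_diff inner_commute)
  have *: "(dist (pt X Y) u)\<^sup>2 = (pt X Y - m) \<bullet> (pt X Y - m) - 2 * (X * px u + Y * py u) + (u - m) \<bullet> (u - m)" for u
  proof -
    have "(dist (pt X Y) u)\<^sup>2 = ((pt X Y - m) - (u - m)) \<bullet> ((pt X Y - m) - (u - m))"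
      by (simp add: dist_norm power2_norm_eq_inner)
    also have "\<dots> = (pt X Y - m) \<bullet> (pt X Y - m) - 2 * ((pt X Y - m) \<bullet> (u - m)) + (u - m) \<bullet> (u - m)"
      by (rule sq)
    finally show ?thesis by (simp add: inner_pt)
  qed
  show ?thesis unfolding *[of v] *[of a] by (simp add: bis_def diff_divide_distrib)
qed

lemma bis_b: "bis b = 0" unfolding bis_def a_minus_m b_minus_m by simp

lemma dist_pt_b: "dist (pt X Y) b = dist (pt X Y) a"
  using dist_pt[of X Y b] by (simp add: bis_b)

lemma dist_pt_le_iff: "dist (pt X Y) a \<le> dist (pt X Y) v \<longleftrightarrow> X * px v + Y * py v \<le> bis v"
  using dist_pt[of X Y v] by (smt (verit) power2_le_imp_le power_mono zero_le_dist)

lemma dist_pt_less_iff: "dist (pt X Y) a < dist (pt X Y) v \<longleftrightarrow> X * px v + Y * py v < bis v"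
  using dist_pt[of X Y v] by (smt (verit) power2_less_imp_less power_strict_mono zero_le_dist pos2)

lemma dist_pt_eq_iff: "dist (pt X Y) v = dist (pt X Y) a \<longleftrightarrow> X * px v + Y * py v = bis v"
  using dist_pt_le_iff[of X Y v] dist_pt_less_iff[of X Y v] by linarith

lemma affine_hull_edge: "affine hull {a, b} = {z. px z = 0 \<and> py z = 0}"
proof
  have eq: "{z. px z = 0 \<and> py z = 0} = {z. e1 \<bullet> z = e1 \<bullet> m} \<inter> {z. e2 \<bullet> z = e2 \<bullet> m}"
    by (auto simp: px_affine py_affine)
  have "affine {z. px z = 0 \<and> py z = 0}"
    unfolding eq by (intro affine_Int affine_hyperplane)
  then show "affine hull {a, b} \<subseteq> {z. px z = 0 \<and> py z = 0}"
    by (rule hull_minimal[rotated]) simp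
  show "{z. px z = 0 \<and> py z = 0} \<subseteq> affine hull {a, b}"
  proof
    fix z assume "z \<in> {z. px z = 0 \<and> py z = 0}"
    then have p: "px z = 0" "py z = 0" by auto
    have "z - m = pz z *\<^sub>R (b - a)"
      using expand[of z] unfolding p by (simp only: scaleR_zero_left add_0_left)
    then have "z = m + pz z *\<^sub>R (b - a)" by (simp only: diff_eq_eq add.commute)
    also have "\<dots> = (1/2 - pz z) *\<^sub>R a + (1/2 + pz z) *\<^sub>R b"
      by (simp add: m_def midpoint_def scaleR_add_left scaleR_diff_left scaleR_add_right scaleR_diff_right)
    finally have "z = (1/2 - pz z) *\<^sub>R a + (1/2 + pz z) *\<^sub>R b" .
    moreover have "(1/2 - pz z) + (1/2 + pz z) = 1" by simp
    ultimately show "z \<in> affine hull {a, b}" unfolding affine_hull_2 by blast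
  qed
qed

lemma turn_affine: "turn v z = (px v *\<^sub>R e2 - py v *\<^sub>R e1) \<bullet> z - (px v *\<^sub>R e2 - py v *\<^sub>R e1) \<bullet> m"
  by (simp add: turn_def px_affine[of z] py_affine[of z] inner_diff_left right_diff_distrib)

lemma affine_hull_triangle:
  assumes "px v \<noteq> 0 \<or> py v \<noteq> 0"
  shows "affine hull {a, b, v} = {z. turn v z = 0}"
proof
  have "{z. turn v z = 0} = {z. (px v *\<^sub>R e2 - py v *\<^sub>R e1) \<bullet> z = (px v *\<^sub>R e2 - py v *\<^sub>R e1) \<bullet> m}"
    by (auto simp: turn_affine)
  then have "affine {z. turn v z = 0}" using affine_hyperplane by metis
  then show "affine hull {a, b, v} \<subseteq> {z. turn v z = 0}"
    by (intro hull_minimal) (auto simp: turn_def)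
  show "{z. turn v z = 0} \<subseteq> affine hull {a, b, v}"
  proof
    fix z assume "z \<in> {z. turn v z = 0}"
    then have t: "px v * py z = py v * px z" by (simp add: turn_def)
    define D where "D = px v * px v + py v * py v"
    have D: "D \<noteq> 0" using assms by (auto simp: D_def add_nonneg_eq_0_iff)
    \<comment> \<open>The factor that scales the projection of \<open>v\<close> to that of
      \<open>z\<close>; the remaining offset along the edge is distributed over \<open>a\<close> and
      \<open>b\<close>.\<close>
    define s where "s = (px v * px z + py v * py z) / D"
    have "s * px v = px z" "s * py v = py z"
      using D t by (simp_all add: s_def D_def field_simps)
    then have "z - m = s *\<^sub>R (v - m) + (pz z - s * pz v) *\<^sub>R (b - a)"
      using expand[of z] expand[of v] by (simp add: scaleR_add_right scaleR_diff_left)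
    then have "z = m + s *\<^sub>R (v - m) + (pz z - s * pz v) *\<^sub>R (b - a)"
      by (simp only: diff_eq_eq ac_simps)
    also have "\<dots> = ((1 - s)/2 - (pz z - s * pz v)) *\<^sub>R a + ((1 - s)/2 + (pz z - s * pz v)) *\<^sub>R b + s *\<^sub>R v"
      by (simp add: m_def midpoint_def scaleR_add_left scaleR_diff_left scaleR_add_right scaleR_diff_right diff_divide_distrib)
    finally have "z = ((1 - s)/2 - (pz z - s * pz v)) *\<^sub>R a + ((1 - s)/2 + (pz z - s * pz v)) *\<^sub>R b + s *\<^sub>R v" .
    moreover have "((1 - s)/2 - (pz z - s * pz v)) + ((1 - s)/2 + (pz z - s * pz v)) + s = 1"
      by simp
    ultimately show "z \<in> affine hull {a, b, v}" unfolding affine_hull_3 by blast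
  qed
qed

lemma independent_triangle:
  assumes "\<not> affine_dependent {a, b, v}" "v \<notin> {a, b}"
  shows "px v \<noteq> 0 \<or> py v \<noteq> 0"
proof (rule ccontr)
  assume "\<not> ?thesis"
  then have "v \<in> affine hull {a, b}" by (simp add: affine_hull_edge)
  moreover have "{a, b, v} - {v} = {a, b}" using assms(2) by auto
  ultimately show False using assms(1) unfolding affine_dependent_def by (metis insertCI)
qed

lemma affine_hull_tetrahedron:
  assumes "\<not> affine_dependent {a, b, v, w}" "card {a, b, v, w} = 4"
  shows "affine hull {a, b, v, w} = UNIV"
  using aff_dim_affine_independent[OF assms(1)] assms(2) by (simp flip: aff_dim_eq_full)

lemma card_4_iff: "card {x, y, v, w} = 4 \<longleftrightarrow> distinct [x, y, v, w]"
  by (auto simp: card_insert_if)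

lemma turn_neq_0:
  assumes "\<not> affine_dependent {a, b, v, w}" "card {a, b, v, w} = 4"
  shows "turn v w \<noteq> 0"
proof
  assume t: "turn v w = 0"
  have "\<not> affine_dependent {a, b, v}" using affine_independent_subset[OF assms(1)] by auto
  then have v: "px v \<noteq> 0 \<or> py v \<noteq> 0"
    using assms(2) by (intro independent_triangle) (auto simp: card_4_iff)
  have "w \<in> affine hull {a, b, v}" using t affine_hull_triangle[OF v] by simp
  moreover have "{a, b, v, w} - {w} = {a, b, v}" using assms(2) by (auto simp: card_4_iff)
  ultimately show False using assms(1) unfolding affine_dependent_def by (metis insertCI)
qed

lemma turn_swap: "turn w v = - turn v w" by (simp add: turn_def)
lemma turn_same [simp]: "turn v v = 0" by (simp add: turn_def)

subsection \<open>Circumcenters\<close>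

lemma circumcenter_edge: "circumcenter (convex hull {a, b}) = m"
proof (rule circumcenter_convex_hull)
  show "m \<in> affine hull {a, b}" by (simp add: affine_hull_edge)
  show "dist m x = dist a b / 2" if "x \<in> {a, b}" for x
    using that by (auto simp: m_def dist_midpoint)
qed auto

text \<open>\<open>foot v\<close> times the projection of \<open>v\<close> is the foot of the
  perpendicular from \<open>m\<close> to the bisector line of \<open>v\<close>. Its sign tells on
  which side of the edge the circumcenter of the triangle lies.\<close>

definition "foot v = bis v / ((px v)\<^sup>2 + (py v)\<^sup>2)"

lemma circumcenter_triangle:
  assumes "\<not> affine_dependent {a, b, v}" "v \<notin> {a, b}"
  shows "circumcenter (convex hull {a, b, v}) = pt (foot v * px v) (foot v * py v)"
proof (rule circumcenter_convex_hull)
  note v = independent_triangle[OF assms]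
  show "pt (foot v * px v) (foot v * py v) \<in> affine hull {a, b, v}"
    by (simp add: affine_hull_triangle[OF v]) (simp add: turn_def)
  have "(px v)\<^sup>2 + (py v)\<^sup>2 \<noteq> 0" using v by (simp add: sum_power2_eq_zero_iff)
  then have "foot v * px v * px v + foot v * py v * py v = bis v"
    by (simp add: foot_def mult.assoc flip: power2_eq_square distrib_left add_divide_distrib)
  then show "dist (pt (foot v * px v) (foot v * py v)) x = dist (pt (foot v * px v) (foot v * py v)) a"
    if "x \<in> {a, b, v}" for x
    using that dist_pt_b dist_pt_eq_iff by auto
qed (use assms in auto)

text \<open>Cramer's rule for the intersection of the bisector lines of \<open>v\<close> and
  \<open>w\<close>.\<close>

definition "ccx v w = (bis v * py w - bis w * py v) / turn v w"
definition "ccy v w = (px v * bis w - px w * bis v) / turn v w"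
abbreviation "cc v w \<equiv> pt (ccx v w) (ccy v w)"

definition "lin v z = px v * px z + py v * py z"

lemma lin_cc:
  assumes "turn v w \<noteq> 0"
  shows "lin v (cc v w) = bis v" "lin w (cc v w) = bis w"
proof -
  have "px v * (bis v * py w - bis w * py v) + py v * (px v * bis w - px w * bis v) = bis v * turn v w"
    "px w * (bis v * py w - bis w * py v) + py w * (px v * bis w - px w * bis v) = bis w * turn v w"
    by (simp_all add: turn_def algebra_simps)
  then show "lin v (cc v w) = bis v" "lin w (cc v w) = bis w"
    using assms by (simp_all add: lin_def ccx_def ccy_def flip: add_divide_distrib)
qed

lemma circumcenter_tetrahedron:
  assumes "\<not> affine_dependent {a, b, v, w}" "card {a, b, v, w} = 4"
  shows "circumcenter (convex hull {a, b, v, w}) = cc v w"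
    and "circumradius (convex hull {a, b, v, w}) = dist (cc v w) a"
proof -
  have "dist (cc v w) x = dist (cc v w) a" if "x \<in> {a, b, v, w}" for x
    using that dist_pt_b dist_pt_eq_iff[of "ccx v w" "ccy v w" v] dist_pt_eq_iff[of "ccx v w" "ccy v w" w]
      lin_cc[OF turn_neq_0[OF assms]]
    by (auto simp: lin_def mult.commute)
  note * = circumcenter_convex_hull[OF assms(1) insert_not_empty _ this]
  show "circumcenter (convex hull {a, b, v, w}) = cc v w"
    by (rule *(1)) (simp add: affine_hull_tetrahedron[OF assms])
  show "circumradius (convex hull {a, b, v, w}) = dist (cc v w) a"
    by (rule *(2)) (simp add: affine_hull_tetrahedron[OF assms])
qed

end

section \<open>Tetrahedra around an interior edge\<close>

locale delaunay_edge = edge_frame +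
  fixes K :: "(real^3) set set"
  assumes K: "simplicial_complex K"
    and delaunay: "nondegenerate_delaunay K"
    and edge: "spans_simplex K {a, b}"
    and interior: "rel_interior (convex hull {a, b}) \<inter> interior (\<Union>K) \<noteq> {}"
begin

definition "tri u \<longleftrightarrow> u \<notin> {a, b} \<and> spans_simplex K {a, b, u}"
definition "tet v w \<longleftrightarrow> card {a, b, v, w} = 4 \<and> spans_simplex K {a, b, v, w}"

lemma tet_swap: "tet v w \<Longrightarrow> tet w v"
  by (simp add: tet_def insert_commute)

lemma tet_tri:
  assumes "tet v w"
  shows "tri v" "tri w"
  using assms spans_simplex_mono[OF K, of "{a, b, v, w}" "{a, b, v}"]
    spans_simplex_mono[OF K, of "{a, b, v, w}" "{a, b, w}"]
  by (auto simp: tet_def tri_def card_4_iff)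

lemma tri_nonzero: "tri v \<Longrightarrow> px v \<noteq> 0 \<or> py v \<noteq> 0"
  using independent_triangle unfolding tri_def spans_simplex_def by blast

lemma tet_turn: "tet v w \<Longrightarrow> turn v w \<noteq> 0"
  using turn_neq_0 unfolding tet_def spans_simplex_def by blast

text \<open>
  Close to the midpoint of the edge a tetrahedron coincides with the wedge over the cone spanned
  by \<open>v\<close> and \<open>w\<close>, so a triangle lying in that wedge meets the tetrahedron in a relative interior
  point and is therefore one of its faces.
\<close>

lemma cone_vertex:
  assumes u: "tri u" and vw: "tet v w" and nn: "0 \<le> \<alpha>" "0 \<le> \<beta>"
    and p: "px u = \<alpha> * px v + \<beta> * px w" "py u = \<alpha> * py v + \<beta> * py w"
  shows "u = v \<or> u = w"
proof -
  define \<gamma> where "\<gamma> = pz u - \<alpha> * pz v - \<beta> * pz w"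
  have "u - m = px u *\<^sub>R e1 + py u *\<^sub>R e2 + pz u *\<^sub>R (b - a)" by (rule expand)
  also have "\<dots> = \<alpha> *\<^sub>R (px v *\<^sub>R e1 + py v *\<^sub>R e2 + pz v *\<^sub>R (b - a)) +
      \<beta> *\<^sub>R (px w *\<^sub>R e1 + py w *\<^sub>R e2 + pz w *\<^sub>R (b - a)) + \<gamma> *\<^sub>R (b - a)"
    unfolding p \<gamma>_def by (simp add: scaleR_add_left scaleR_diff_left scaleR_add_right)
  also have "\<dots> = \<alpha> *\<^sub>R (v - m) + \<beta> *\<^sub>R (w - m) + \<gamma> *\<^sub>R (b - a)"
    by (simp only: expand[symmetric])
  finally have um: "u - m = \<alpha> *\<^sub>R (v - m) + \<beta> *\<^sub>R (w - m) + \<gamma> *\<^sub>R (b - a)" .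
  \<comment> \<open>Scaling \<open>u - m\<close> by \<open>1 / D\<close> keeps the weights of
    \<open>a\<close> and \<open>b\<close> in the tetrahedron nonnegative even after they absorb the
    offset \<open>\<gamma>\<close> along the edge; the summand 2 also makes
    \<open>\<epsilon> < 1\<close>.\<close>
  define D where "D = 2 + \<alpha> + \<beta> + 2 * \<bar>\<gamma>\<bar>"
  have D: "D \<ge> 2" using nn by (simp add: D_def)
  define \<epsilon> where "\<epsilon> = 1 / D"
  have e: "0 < \<epsilon>" "\<epsilon> < 1" using D by (auto simp: \<epsilon>_def)
  have "\<epsilon> * D = 1" using D by (simp add: \<epsilon>_def)
  then have eD: "2 * \<epsilon> + \<epsilon> * \<alpha> + \<epsilon> * \<beta> + 2 * \<bar>\<epsilon> * \<gamma>\<bar> = 1"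
    using e by (simp add: D_def algebra_simps abs_mult)
  define q where "q = m + \<epsilon> *\<^sub>R (u - m)"
  have "q = ((1 - \<epsilon>)/2) *\<^sub>R a + ((1 - \<epsilon>)/2) *\<^sub>R b + \<epsilon> *\<^sub>R u"
    by (simp add: q_def m_def midpoint_def scaleR_diff_right scaleR_add_right diff_divide_distrib scaleR_diff_left)
  also have "\<dots> \<in> rel_interior (convex hull {a, b, u})"
    using u e ab unfolding tri_def spans_simplex_def by (intro rel_interior_triangle_mem) auto
  finally have q1: "q \<in> rel_interior (convex hull {a, b, u})" .
  have "q = (1/2 - \<epsilon> * \<alpha> / 2 - \<epsilon> * \<beta> / 2 - \<epsilon> * \<gamma>) *\<^sub>R a + (1/2 - \<epsilon> * \<alpha> / 2 - \<epsilon> * \<beta> / 2 + \<epsilon> * \<gamma>) *\<^sub>R b +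
      (\<epsilon> * \<alpha>) *\<^sub>R v + (\<epsilon> * \<beta>) *\<^sub>R w"
    unfolding q_def um
    by (simp add: m_def midpoint_def scaleR_diff_right scaleR_add_right scaleR_add_left scaleR_diff_left)
  also have "\<dots> \<in> convex hull {a, b, v, w}"
    using nn e eD by (intro convex_hull_4_mem) auto
  finally have q2: "q \<in> convex hull {a, b, v, w}" .
  have "{a, b, u} \<subseteq> {a, b, v, w}"
    using spans_simplex_rel_interior_subset[OF K _ _ q1 q2] u vw by (simp add: tri_def tet_def)
  then show ?thesis using u by (auto simp: tri_def)
qed

text \<open>Cramer's rule for the projection of \<open>u\<close> in the basis given by
  \<open>v\<close> and \<open>w\<close>, with the denominator cleared.\<close>

lemma turn_identity:
  "px u * turn v w = turn u w * px v + turn v u * px w"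
  "py u * turn v w = turn u w * py v + turn v u * py w"
  by (simp_all add: turn_def algebra_simps)

lemma cone_vertex_turn:
  assumes "tri u" "tet v w" "0 \<le> turn u w * turn v w" "0 \<le> turn v u * turn v w"
  shows "u = v \<or> u = w"
proof (rule cone_vertex[OF assms(1,2)])
  note t = tet_turn[OF assms(2)]
  show "0 \<le> turn u w / turn v w" "0 \<le> turn v u / turn v w"
    using assms(3,4) by (auto simp: zero_le_mult_iff zero_le_divide_iff)
  show "px u = turn u w / turn v w * px v + turn v u / turn v w * px w"
    "py u = turn u w / turn v w * py v + turn v u / turn v w * py w"
    using turn_identity[of u v w] t by (simp_all add: field_simps)
qed

text \<open>Of two apices on the same side of \<open>v\<close>, the one at the smaller angle from
  \<open>v\<close> lies in the cone spanned by \<open>v\<close> and the other, so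
  \<open>cone_vertex_turn\<close> identifies them.\<close>

lemma neighbour_unique:
  assumes "tet v w" "tet v w'" "0 < turn v w * turn v w'"
  shows "w = w'"
proof (cases "0 \<le> turn w' w * turn v w")
  case True
  then have "w' = v \<or> w' = w"
    using assms
      by (intro cone_vertex_turn[OF tet_tri(2)[OF assms(2)] assms(1)]) (auto simp: mult.commute)
  then show ?thesis using assms(3) by auto
next
  case False
  then have "0 \<le> turn w w' * turn v w'"
    using assms(3) turn_swap[of w w']
      by (auto simp: zero_less_mult_iff not_le mult_less_0_iff mult_le_0_iff)
  then have "w = v \<or> w = w'"
    using assms by (intro cone_vertex_turn[OF tet_tri(2)[OF assms(1)] assms(2)]) auto
  then show ?thesis using assms(3) by auto
qed

text \<open>Just off the edge in direction \<open>e1\<close> lies a point of a simplex containing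
  the edge. There \<open>px\<close> is positive, so it is positive at some vertex of that simplex,
  which serves as apex.\<close>

lemma ex_tri: "\<exists>v. tri v"
proof -
  obtain q where q: "q \<in> rel_interior (convex hull {a, b})" "q \<in> interior (\<Union>K)"
    using interior by blast
  obtain B s where B: "spans_simplex K B" "{a, b} \<subseteq> B" "0 < s" "q + s *\<^sub>R e1 \<in> convex hull B"
    using simplicial_complex_direction[OF K edge q] .
  have "q \<in> affine hull {a, b}"
    using q(1) rel_interior_subset convex_hull_subset_affine_hull by blast
  then have "px q = 0" by (simp add: affine_hull_edge)
  then have pos: "0 < px (q + s *\<^sub>R e1)"
    using B(3) by (simp add: px_affine inner_add_right e11)
  have "\<exists>v\<in>B. 0 < px v"
  proof (rule ccontr)
    assume "\<not> ?thesis"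
    then have "convex hull B \<subseteq> {z. e1 \<bullet> z \<le> e1 \<bullet> m}"
      by (intro hull_minimal convex_halfspace_le) (auto simp: px_affine not_less)
    then show False using B(4) pos by (auto simp: px_affine)
  qed
  then obtain v where v: "v \<in> B" "0 < px v" by blast
  then have "tri v" using spans_simplex_mono[OF K B(1), of "{a, b, v}"] B(2) by (auto simp: tri_def)
  then show ?thesis ..
qed

text \<open>The argument of \<open>ex_tri\<close>, now leaving the open triangle along its normal;
  the sign of \<open>\<sigma>\<close> selects the side.\<close>

lemma ex_neighbour:
  assumes v: "tri v" and \<sigma>: "\<sigma> \<noteq> 0"
  shows "\<exists>w. tet v w \<and> 0 < \<sigma> * turn v w"
proof -
  have vv: "\<not> affine_dependent {a, b, v}" "v \<notin> {a, b}" "spans_simplex K {a, b, v}"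
    using v by (auto simp: tri_def spans_simplex_def)
  obtain q where q: "q \<in> rel_interior (convex hull {a, b})" "q \<in> interior (\<Union>K)"
    using interior by blast
  have "\<not> affine_dependent {a, b}" using edge by (simp add: spans_simplex_def)
  from q(1)[unfolded rel_interior_convex_hull_explicit[OF this]]
  obtain f where f: "0 < f a" "0 < f b" "f a + f b = 1" "q = f a *\<^sub>R a + f b *\<^sub>R b"
    using ab by auto
  obtain r where r: "0 < r" "ball q r \<subseteq> interior (\<Union>K)"
    using q(2) open_contains_ball open_interior by blast
  \<comment> \<open>Keeps \<open>x\<close> inside the ball around \<open>q\<close> and leaves
    positive weight on \<open>a\<close> and \<open>b\<close>; the summand 1 avoids a zero
    denominator.\<close>
  define s where "s = min (1/2) (r / (norm (v - q) + 1))"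
  have n: "0 < norm (v - q) + 1" by (simp add: add_nonneg_pos)
  have s: "0 < s" "s < 1" using r(1) n by (auto simp: s_def)
  have "s * (norm (v - q) + 1) \<le> r / (norm (v - q) + 1) * (norm (v - q) + 1)"
    using n by (intro mult_right_mono) (auto simp: s_def)
  also have "\<dots> = r" using n by simp
  finally have "s * norm (v - q) + s \<le> r" by (simp add: distrib_left)
  then have sr: "s * norm (v - q) < r" using s by simp
  define x where "x = q + s *\<^sub>R (v - q)"
  have x2: "x \<in> interior (\<Union>K)"
    using r(2) sr s by (intro subsetD[OF r(2)]) (auto simp: x_def dist_norm)
  have "x = ((1 - s) * f a) *\<^sub>R a + ((1 - s) * f b) *\<^sub>R b + s *\<^sub>R v"
    unfolding x_def f(4) by (simp add: algebra_simps)
  also have "\<dots> \<in> rel_interior (convex hull {a, b, v})"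
  proof (intro rel_interior_triangle_mem vv ab)
    have "(1 - s) * f a + (1 - s) * f b = 1 - s"
      using f(3) by (metis distrib_left mult.right_neutral)
    then show "(1 - s) * f a + (1 - s) * f b + s = 1" by simp
  qed (use s f in auto)
  finally have x1: "x \<in> rel_interior (convex hull {a, b, v})" .
  let ?g = "px v *\<^sub>R e2 - py v *\<^sub>R e1"
  obtain B t where B: "spans_simplex K B" "{a, b, v} \<subseteq> B" "0 < t"
      "x + t *\<^sub>R (\<sigma> *\<^sub>R ?g) \<in> convex hull B"
    using simplicial_complex_direction[OF K vv(3) x1 x2] .
  have "x \<in> affine hull {a, b, v}"
    using x1 rel_interior_subset convex_hull_subset_affine_hull by blast
  then have "turn v x = 0" using affine_hull_triangle[OF tri_nonzero[OF v]] by simp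
  then have eq: "turn v (x + t *\<^sub>R (\<sigma> *\<^sub>R ?g)) = t * \<sigma> * (?g \<bullet> ?g)"
    by (simp add: turn_affine[of v x] turn_affine[of v "x + _"] inner_add_right)
  have "?g \<bullet> ?g = px v * px v + py v * py v"
    by (simp add: inner_diff_left inner_diff_right e11 e22 e12 e21)
  then have "0 < ?g \<bullet> ?g"
    using tri_nonzero[OF v] by (simp only: sum_squares_gt_zero_iff)
  moreover have "0 < \<sigma> * \<sigma>" using \<sigma> not_real_square_gt_zero by blast
  ultimately have "0 < t * (\<sigma> * \<sigma>) * (?g \<bullet> ?g)" using B(3) by (metis mult_pos_pos)
  then have pos: "0 < \<sigma> * turn v (x + t *\<^sub>R (\<sigma> *\<^sub>R ?g))"
    unfolding eq by (simp only: ac_simps)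
  have "\<exists>w\<in>B. 0 < \<sigma> * turn v w"
  proof (rule ccontr)
    assume "\<not> ?thesis"
    then have "convex hull B \<subseteq> {z. (\<sigma> *\<^sub>R ?g) \<bullet> z \<le> (\<sigma> *\<^sub>R ?g) \<bullet> m}"
      by (intro hull_minimal convex_halfspace_le)
        (auto simp: turn_affine[of v] right_diff_distrib not_less)
    then show False
      using B(4) pos by (auto simp: turn_affine[of v "x + _"] right_diff_distrib)
  qed
  then obtain w where w: "w \<in> B" "0 < \<sigma> * turn v w" by blast
  have "w \<notin> {a, b, v}" using w(2) by (auto simp: turn_def)
  then have "tet v w"
    using spans_simplex_mono[OF K B(1), of "{a, b, v, w}"] B(2) w(1) vv(2) ab
    by (auto simp: tet_def card_4_iff)
  then show ?thesis using w(2) by blast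
qed

lemma finite_tri: "finite {u. tri u}"
proof -
  have "{u} \<in> K" if "tri u" for u
    using spans_simplex_mono[OF K, of "{a, b, u}" "{u}"] that
      by (simp add: tri_def spans_simplex_def)
  then have "(\<lambda>u. {u}) ` {u. tri u} \<subseteq> K" by auto
  then have "finite ((\<lambda>u. {u}) ` {u. tri u})"
    using K unfolding simplicial_complex_def by (meson finite_subset)
  then show ?thesis by (rule finite_imageD) (simp add: inj_on_def)
qed

subsection \<open>The Delaunay condition\<close>

lemma lin_pt: "lin u (pt X Y) = X * px u + Y * py u" by (simp add: lin_def)

lemma tet_in_K:
  assumes "tet v w"
  shows "convex hull {a, b, v, w} \<in> K" "3 simplex (convex hull {a, b, v, w})"
    "circumcenter (convex hull {a, b, v, w}) = cc v w"
    "circumradius (convex hull {a, b, v, w}) = dist (cc v w) a"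
proof -
  have t: "\<not> affine_dependent {a, b, v, w}" "card {a, b, v, w} = 4" "spans_simplex K {a, b, v, w}"
    using assms by (auto simp: tet_def spans_simplex_def)
  show "convex hull {a, b, v, w} \<in> K" using t(3) by (simp add: spans_simplex_def)
  show "3 simplex (convex hull {a, b, v, w})"
    using spans_simplex_simplex_iff[OF t(3)] t(2) by simp
qed (use assms circumcenter_tetrahedron in \<open>auto simp: tet_def spans_simplex_def\<close>)

text \<open>The vertex \<open>a\<close> lies on the circumsphere, so emptiness of the ball compares
  the distances from its center to \<open>a\<close> and to \<open>u\<close>, which
  \<open>dist_pt_le_iff\<close> makes linear.\<close>

lemma lin_le_bis:
  assumes "tet v w" "tri u"
  shows "lin u (cc v w) \<le> bis u"
proof -
  have "{u} \<in> K"
    using spans_simplex_mono[OF K, of "{a, b, u}" "{u}"] assms(2)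
      by (simp add: tri_def spans_simplex_def)
  then have "u \<notin> ball (cc v w) (dist (cc v w) a)"
    using delaunay tet_in_K[OF assms(1)] unfolding nondegenerate_delaunay_def delaunay_def by metis
  then show ?thesis by (simp add: not_less dist_pt_le_iff lin_pt)
qed

lemma tri_simplex:
  assumes "tri u"
  shows "convex hull {a, b, u} \<in> K" "2 simplex (convex hull {a, b, u})"
proof -
  have "card {a, b, u} = 3" using assms ab by (auto simp: tri_def)
  then show "convex hull {a, b, u} \<in> K" "2 simplex (convex hull {a, b, u})"
    using assms spans_simplex_simplex_iff[of K "{a, b, u}" 2]
      by (auto simp: tri_def spans_simplex_def)
qed

lemma tet_Int_tet:
  assumes "tet v w" "tet w u" "u \<noteq> v"
  shows "convex hull {a, b, v, w} \<inter> convex hull {a, b, w, u} = convex hull {a, b, w}"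
proof -
  have "{a, b, v, w} \<inter> {a, b, w, u} = {a, b, w}"
    using assms by (auto simp: tet_def card_4_iff)
  then show ?thesis
    using convex_hull_Int_simplicial_complex[OF K] assms by (metis tet_def)
qed

text \<open>Non-degeneracy enters here. It later forces consecutive circumcenters to differ and
  makes one term of the area strictly positive.\<close>

lemma lin_less_bis:
  assumes vw: "tet v w" and wu: "tet w u" and "u \<noteq> v"
  shows "lin u (cc v w) < bis u"
proof -
  let ?S = "convex hull {a, b, v, w}" and ?S' = "convex hull {a, b, w, u}"
  note I = tet_Int_tet[OF assms]
  have s: "spans_simplex K {a, b, w, u}" "spans_simplex K {a, b, w}" "tri w"
    using wu tet_tri(1)[OF wu] unfolding tet_def tri_def by blast+
  have "2 simplex (?S \<inter> ?S')" unfolding I using tri_simplex[OF s(3)] by simp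
  moreover have "u extreme_point_of ?S'"
    using s(1) extreme_point_of_convex_hull_affine_independent by (auto simp: spans_simplex_def)
  moreover have "u \<notin> ?S \<inter> ?S'"
  proof
    assume "u \<in> ?S \<inter> ?S'"
    moreover have "spans_simplex K {u}" using spans_simplex_mono[OF K s(1)] by simp
    ultimately have "{u} \<subseteq> {a, b, w}"
      using spans_simplex_subset_iff[OF K _ s(2), of "{u}"] I by auto
    then show False using wu by (auto simp: tet_def card_4_iff)
  qed
  ultimately have "dist (cc v w) a < dist (cc v w) u"
    using delaunay tet_in_K[OF vw] tet_in_K[OF wu] unfolding nondegenerate_delaunay_def by metis
  then show ?thesis by (simp add: dist_pt_less_iff lin_pt)
qed

text \<open>A successor relation: \<open>w\<close> is the next apex after \<open>v\<close>,
  counterclockwise in the frame. By \<open>neighbour_unique\<close> it is functional in both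
  directions.\<close>

definition "pos v w \<longleftrightarrow> tet v w \<and> 0 < turn v w"

lemma pos_tri: "pos v w \<Longrightarrow> tri v" "pos v w \<Longrightarrow> tri w"
  using tet_tri by (auto simp: pos_def)

lemma pos_functional: "pos v w \<Longrightarrow> pos v w' \<Longrightarrow> w = w'"
  using neighbour_unique by (auto simp: pos_def)

lemma pos_injective: "pos v w \<Longrightarrow> pos v' w \<Longrightarrow> v = v'"
  using neighbour_unique[of w v v'] tet_swap turn_swap[of w v] turn_swap[of w v']
    by (auto simp: pos_def)

lemma pos_asym: "pos v w \<Longrightarrow> \<not> pos w v"
  using turn_swap[of v w] by (auto simp: pos_def)

lemma pos_irrefl: "\<not> pos v v"
  using pos_asym by blast

lemma ex_pos: "tri v \<Longrightarrow> \<exists>w. pos v w"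
  using ex_neighbour[of v 1] by (auto simp: pos_def)

lemma lin_cc_pos:
  assumes "pos v w"
  shows "lin v (cc v w) = bis v" "lin w (cc v w) = bis w"
  using lin_cc tet_turn assms by (auto simp: pos_def)

text \<open>Both circumcenters lie on the bisector line of the shared apex \<open>w\<close>, so they
  differ by a multiple of the rotated normal. The multiple is positive since \<open>lin u\<close> is
  below \<open>bis u\<close> at the first and equal to it at the second.\<close>

lemma cc_step:
  assumes "pos v w" "pos w u"
  obtains t where "0 < t" "ccx w u - ccx v w = - t * py w" "ccy w u - ccy v w = t * px w"
proof -
  define dx dy D t where "dx = ccx w u - ccx v w" and "dy = ccy w u - ccy v w"
    and "D = px w * px w + py w * py w" and "t = (px w * dy - py w * dx) / D"
  have D: "D \<noteq> 0"
    using tri_nonzero[OF pos_tri(2)[OF assms(1)]] by (auto simp: D_def add_nonneg_eq_0_iff)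
  have perp: "px w * dx + py w * dy = 0"
    using lin_cc_pos(2)[OF assms(1)] lin_cc_pos(1)[OF assms(2)]
      by (simp add: lin_pt dx_def dy_def algebra_simps)
  have "D * t = px w * dy - py w * dx" using D by (simp add: t_def)
  then have "D * (dx + t * py w) = 0" "D * (dy - t * px w) = 0"
    using perp unfolding D_def by algebra+
  then have eq: "dx = - t * py w" "dy = t * px w" using D by auto
  have "u \<noteq> v" using assms pos_asym by blast
  then have "lin u (cc v w) < lin u (cc w u)"
    using lin_less_bis[of v w u] lin_cc_pos(2)[OF assms(2)] assms by (simp add: pos_def)
  then have "0 < px u * dx + py u * dy" by (simp add: lin_pt dx_def dy_def algebra_simps)
  also have "\<dots> = t * turn w u" unfolding eq by (simp add: turn_def algebra_simps)
  finally have "0 < t" using assms(2) by (simp add: pos_def zero_less_mult_iff)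
  then show ?thesis using that eq by (simp add: dx_def dy_def)
qed

text \<open>By \<open>cc_step\<close> the neighbouring circumcenters lie along the rotated normals,
  so the two inequalities say that the Cramer coefficients of \<open>(p, q)\<close> with respect to
  \<open>v\<close> and \<open>w\<close> are nonnegative.\<close>

lemma maximal_functional_in_cone:
  assumes pos: "pos v' v" "pos v w" "pos w w'"
    and le: "p * (ccx w w' - ccx v w) + q * (ccy w w' - ccy v w) \<le> 0"
      "p * (ccx v' v - ccx v w) + q * (ccy v' v - ccy v w) \<le> 0"
  shows "\<exists>\<alpha>\<ge>0. \<exists>\<beta>\<ge>0. p = \<alpha> * px v + \<beta> * px w \<and> q = \<alpha> * py v + \<beta> * py w"
proof -
  obtain t where t: "0 < t" "ccx w w' - ccx v w = - t * py w" "ccy w w' - ccy v w = t * px w"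
    using cc_step[OF pos(2,3)] .
  obtain s where s: "0 < s" "ccx v w - ccx v' v = - s * py v" "ccy v w - ccy v' v = s * px v"
    using cc_step[OF pos(1,2)] .
  have "t * (q * px w - p * py w) \<le> 0" using le(1) unfolding t(2,3) by (simp add: algebra_simps)
  then have 1: "q * px w - p * py w \<le> 0" using t(1) by (simp add: mult_le_0_iff)
  have s': "ccx v' v - ccx v w = s * py v" "ccy v' v - ccy v w = - s * px v"
    using s(2,3) by linarith+
  have "s * (p * py v - q * px v) \<le> 0" using le(2) unfolding s' by (simp add: algebra_simps)
  then have 2: "p * py v - q * px v \<le> 0" using s(1) by (simp add: mult_le_0_iff)
  have T: "0 < turn v w" using pos(2) by (simp add: pos_def)
  define \<alpha> \<beta> where "\<alpha> = (p * py w - q * px w) / turn v w" and "\<beta> = (q * px v - p * py v) / turn v w"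
  have "0 \<le> \<alpha>" "0 \<le> \<beta>" using 1 2 T by (auto simp: \<alpha>_def \<beta>_def)
  moreover have "p * turn v w = (p * py w - q * px w) * px v + (q * px v - p * py v) * px w"
    "q * turn v w = (p * py w - q * px w) * py v + (q * px v - p * py v) * py w"
    by (simp_all add: turn_def algebra_simps)
  then have "p = \<alpha> * px v + \<beta> * px w" "q = \<alpha> * py v + \<beta> * py w"
    using T by (simp_all add: \<alpha>_def \<beta>_def eq_divide_eq flip: add_divide_distrib)
  ultimately show ?thesis by blast
qed

lemma maximal_lin_vertex:
  assumes "pos v' v" "pos v w" "pos w w'" "tri u"
    and "lin u (cc w w') \<le> lin u (cc v w)" "lin u (cc v' v) \<le> lin u (cc v w)"
  shows "u = v \<or> u = w"
proof -
  have "\<exists>\<alpha>\<ge>0. \<exists>\<beta>\<ge>0. px u = \<alpha> * px v + \<beta> * px w \<and> py u = \<alpha> * py v + \<beta> * py w"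
    using assms(5,6)
      by (intro maximal_functional_in_cone[OF assms(1-3)]) (simp_all add: lin_pt algebra_simps)
  then show ?thesis using cone_vertex[OF assms(4), of v w] assms(2) by (auto simp: pos_def)
qed

subsection \<open>Fans of tetrahedra\<close>

abbreviation "tri_hull u \<equiv> convex hull {a, b, u}"
abbreviation "tet_hull v w \<equiv> convex hull {a, b, v, w}"

definition "fan N x \<longleftrightarrow>
  3 \<le> N \<and> (\<forall>i. x (i + N) = x i) \<and> inj_on x {..<N} \<and> (\<forall>i. pos (x i) (x (Suc i)))"

lemma fanD:
  assumes "fan N x"
  shows "3 \<le> N" "x (i + N) = x i" "x (Suc (i + N)) = x (Suc i)" "inj_on x {..<N}" "pos (x i) (x (Suc i))" "tri (x i)"
proof -
  show pos: "pos (x i) (x (Suc i))" for i using assms by (simp add: fan_def)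
  show "tri (x i)" using pos_tri(1)[OF pos] .
qed (use assms in \<open>auto simp: fan_def simp flip: add_Suc\<close>)

lemma fan_mod:
  assumes "fan N x"
  shows "x (i mod N) = x i" "x (Suc (i mod N)) = x (Suc i)"
  using periodic_mod[of x] periodic_mod[of "\<lambda>i. x (Suc i)"] fanD(2,3)[OF assms] by blast+

lemma fan_Suc:
  assumes "fan N x"
  obtains k where "x i = x (Suc k)" "x (Suc i) = x (Suc (Suc k))"
\<comment> \<open>Adding a period before subtracting 1 gives index 0 a predecessor as well.\<close>
proof (rule that[of "i + N - 1"])
  have "Suc (i + N - 1) = i + N" using fanD(1)[OF assms] by simp
  then show "x i = x (Suc (i + N - 1))" "x (Suc i) = x (Suc (Suc (i + N - 1)))"
    using fanD(2,3)[OF assms] by simp_all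
qed

lemma fan_eq_iff:
  assumes "fan N x" "i < N" "j < N"
  shows "x i = x j \<longleftrightarrow> i = j"
  using fanD(4)[OF assms(1)] assms(2,3) by (auto simp: inj_on_def)

lemma fan_maximal_vertex:
  assumes x: "fan N x" and u: "tri u" and max: "\<And>j. lin u (cc (x j) (x (Suc j))) \<le> lin u (cc (x i) (x (Suc i)))"
  shows "u = x i \<or> u = x (Suc i)"
proof -
  obtain k where k: "x i = x (Suc k)" "x (Suc i) = x (Suc (Suc k))" using fan_Suc[OF x] .
  show ?thesis
    unfolding k using max[of k] max[of "Suc (Suc k)"] unfolding k
    by (intro maximal_lin_vertex[OF fanD(5)[OF x] fanD(5)[OF x] fanD(5)[OF x] u])
qed

text \<open>
  The fan closes up around the edge because some circumcenter of the fan maximizes \<open>lin u\<close>, which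
  forces \<open>u\<close> into the corresponding wedge.
\<close>

lemma fan_covers:
  assumes x: "fan N x" and u: "tri u"
  shows "\<exists>i<N. u = x i"
proof -
  let ?f = "\<lambda>i. lin u (cc (x i) (x (Suc i)))"
  have N: "0 < N" using fanD(1)[OF x] by simp
  have "Max (?f ` {..<N}) \<in> ?f ` {..<N}" using N by (intro Max_in) auto
  then obtain i where i: "?f i = Max (?f ` {..<N})" by auto
  have "?f j \<le> ?f i" for j
  proof -
    have "?f j = ?f (j mod N)" using fan_mod[OF x, of j] by simp
    also have "\<dots> \<le> Max (?f ` {..<N})" using N by (intro Max_ge) auto
    finally show ?thesis using i by simp
  qed
  then have "u = x i \<or> u = x (Suc i)" by (rule fan_maximal_vertex[OF x u])
  then show ?thesis using fan_mod(1)[OF x] N by (metis mod_less_divisor)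
qed

text \<open>Following successors in a finite set repeats an apex; uniqueness of predecessors moves
  the repetition back to the start, so the least return time is a period. Asymmetry of
  \<open>pos\<close> excludes periods 1 and 2.\<close>

lemma ex_fan: "\<exists>N x. fan N x"
proof -
  obtain v0 where v0: "tri v0" using ex_tri ..
  obtain nx where nx: "\<And>v. tri v \<Longrightarrow> pos v (nx v)" using ex_pos by metis
  define x where "x i = (nx ^^ i) v0" for i
  have tri: "tri (x i)" for i
    by (induction i) (auto simp: x_def v0 intro: pos_tri(2)[OF nx])
  have pos: "pos (x i) (x (Suc i))" for i
    using nx[OF tri[of i]] by (simp add: x_def)
  have shift: "x i = x (i + d) \<Longrightarrow> x 0 = x d" for i d
  proof (induction i)
    case (Suc i)
    then have "x i = x (i + d)" using pos_injective[OF pos[of i]] pos[of "i + d"] by simp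
    then show ?case by (rule Suc.IH)
  qed simp
  have "range x \<subseteq> {u. tri u}" using tri by auto
  then have "finite (range x)" using finite_tri finite_subset by blast
  then have "\<not> inj x" using finite_imageD infinite_UNIV_nat by blast
  then obtain i j where "i < j" "x i = x j" by (metis injI linorder_neqE_nat)
  then have "x 0 = x (j - i)" "0 < j - i" using shift[of i "j - i"] by auto
  then have ex: "\<exists>n. 0 < n \<and> x 0 = x n" by blast
  define N where "N = (LEAST n. 0 < n \<and> x 0 = x n)"
  have N: "0 < N" "x 0 = x N" using LeastI_ex[OF ex] by (auto simp: N_def)
  have least: "N \<le> n" if "0 < n" "x 0 = x n" for n
    using that unfolding N_def by (intro Least_le) auto
  have per: "x (i + N) = x i" for i
  proof (induction i)
    case (Suc i)
    then show ?case using pos_functional[OF pos[of i]] pos[of "i + N"] by simp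
  qed (simp add: N)
  have "i = j" if "i < j" "j < N" "x i = x j" for i j
    using shift[of i "j - i"] least[of "j - i"] that by auto
  then have "inj_on x {..<N}" by (intro linorder_inj_onI) auto
  moreover have "N \<noteq> 1" using N pos[of 0] pos_irrefl by auto
  moreover have "N \<noteq> 2"
  proof
    assume "N = 2"
    then have "pos (x 1) (x 0)" using pos[of 1] per[of 0] by (simp add: numeral_2_eq_2)
    then show False using pos[of 0] pos_asym by auto
  qed
  ultimately have "fan N x" using N per pos by (auto simp: fan_def)
  then show ?thesis by blast
qed

lemma pos_in_K:
  assumes "pos v w"
  shows "circumcenter (tet_hull v w) = cc v w"
  using assms tet_in_K by (simp add: pos_def)

lemma pt_affine_hull: "pt X Y \<in> affine hull {m, m + e1, m + e2}"
proof -
  have "pt X Y = (1 - X - Y) *\<^sub>R m + X *\<^sub>R (m + e1) + Y *\<^sub>R (m + e2)"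
    by (simp add: pt_def scaleR_diff_left scaleR_add_right)
  moreover have "(1 - X - Y) + X + Y = 1" by simp
  ultimately show ?thesis unfolding affine_hull_3 by blast
qed

lemma fan_polygon:
  assumes x: "fan N x"
  defines "ps \<equiv> map (\<lambda>i. circumcenter (tet_hull (x i) (x (Suc i)))) [0..<N]"
  shows "simple_polygon ps" "convex_polygon ps" "coplanar (set ps)"
proof -
  define c where "c i = cc (x i) (x (Suc i))" for i
  \<comment> \<open>Side \<open>i\<close> is dual to the triangle shared by tetrahedra
    \<open>i\<close> and \<open>Suc i\<close>, whose apex is \<open>x (Suc i)\<close>; hence the
    shift. \<open>h0\<close> accounts for pairing with \<open>z\<close> instead of
    \<open>z - m\<close>.\<close>
  define h where "h i = px (x (Suc i)) *\<^sub>R e1 + py (x (Suc i)) *\<^sub>R e2" for i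
  define h0 where "h0 i = h i \<bullet> m" for i
  define \<beta> where "\<beta> i = bis (x (Suc i)) + h0 i" for i
  have ps: "ps = map c [0..<N]"
    unfolding ps_def c_def using pos_in_K[OF fanD(5)[OF x]] by simp
  have h: "h i \<bullet> z = lin (x (Suc i)) z + h0 i" for i z
    unfolding h0_def h_def lin_def px_affine[of z] py_affine[of z]
    by (simp add: inner_add_left right_diff_distrib)
  have c_iff: "c i = c j \<longleftrightarrow> x i = x j" for i j
  proof
    assume "x i = x j"
    moreover then have "x (Suc i) = x (Suc j)" using fanD(5)[OF x] pos_functional by metis
    ultimately show "c i = c j" by (simp add: c_def)
  next
    assume eq: "c i = c j"
    \<comment> \<open>As \<open>lin u\<close> never exceeds \<open>bis u\<close> on the fan,
      equality at \<open>c j\<close> makes \<open>c j\<close> a maximizer.\<close>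
    have *: "u = x j \<or> u = x (Suc j)" if "tri u" "lin u (c j) = bis u" for u
      using that lin_le_bis[OF _ that(1)] fanD(5)[OF x]
      by (intro fan_maximal_vertex[OF x]) (auto simp: c_def pos_def)
    have "x i = x j \<or> x i = x (Suc j)" "x (Suc i) = x j \<or> x (Suc i) = x (Suc j)"
      using * fanD(6)[OF x] lin_cc_pos[OF fanD(5)[OF x, of i]] eq by (auto simp: c_def)
    then show "x i = x j"
      using fanD(5)[OF x, of i] fanD(5)[OF x, of j] pos_asym pos_irrefl by metis
  qed
  interpret supported_polygon N c h \<beta>
  proof
    show "3 \<le> N" using fanD(1)[OF x] .
    show "c (i + N) = c i" for i using fanD(2,3)[OF x] by (simp add: c_def)
    show "inj_on c {..<N}" using fanD(4)[OF x] by (simp add: inj_on_def c_iff)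
    show "h i \<bullet> c j \<le> \<beta> i" for i j
      using lin_le_bis[OF _ fanD(6)[OF x]] fanD(5)[OF x] by (auto simp: h \<beta>_def c_def pos_def)
    show "h i \<bullet> c j = \<beta> i \<longleftrightarrow> c j = c i \<or> c j = c (Suc i)" for i j
    proof
      assume "h i \<bullet> c j = \<beta> i"
      then have "lin (x (Suc i)) (c j) = bis (x (Suc i))" by (simp add: h \<beta>_def)
      then have "x (Suc i) = x j \<or> x (Suc i) = x (Suc j)"
        using lin_le_bis[OF _ fanD(6)[OF x]] fanD(5)[OF x]
        by (intro fan_maximal_vertex[OF x fanD(6)[OF x]]) (auto simp: c_def pos_def)
      then have "x (Suc i) = x j \<or> x i = x j"
        using fanD(5)[OF x] pos_injective by metis
      then show "c j = c i \<or> c j = c (Suc i)" using c_iff by metis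
    next
      assume "c j = c i \<or> c j = c (Suc i)"
      then show "h i \<bullet> c j = \<beta> i"
        using lin_cc_pos(2)[OF fanD(5)[OF x, of i]] lin_cc_pos(1)[OF fanD(5)[OF x, of "Suc i"]]
        by (auto simp: h \<beta>_def c_def)
    qed
  qed
  show "simple_polygon ps" unfolding ps by (rule simple_polygon_ps)
  have hull: "range c \<subseteq> affine hull {m, m + e1, m + e2}" using pt_affine_hull by (auto simp: c_def)
  then show "coplanar (set ps)" unfolding coplanar_def ps by (intro exI) auto
  show "convex_polygon ps"
    unfolding ps
  proof (rule convex_polygon_ps)
    have "aff_dim (range c) \<le> aff_dim {m, m + e1, m + e2}"
      using aff_dim_subset[OF hull] by simp
    also have "\<dots> \<le> int (card {m, m + e1, m + e2}) - 1" by (rule aff_dim_le_card) simp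
    also have "\<dots> \<le> 2" by (simp add: card_insert_if)
    finally show "aff_dim (range c) \<le> 2" .
  next
    fix w i assume le: "w \<bullet> c i \<le> w \<bullet> c (Suc i)" "w \<bullet> c (Suc (Suc i)) \<le> w \<bullet> c (Suc i)"
    have wc: "w \<bullet> (c k - c j) = (w \<bullet> e1) * (ccx (x k) (x (Suc k)) - ccx (x j) (x (Suc j))) +
        (w \<bullet> e2) * (ccy (x k) (x (Suc k)) - ccy (x j) (x (Suc j)))" for k j
      unfolding c_def by (rule inner_pt_diff)
    have "\<exists>\<alpha>\<ge>0. \<exists>\<beta>\<ge>0. w \<bullet> e1 = \<alpha> * px (x (Suc i)) + \<beta> * px (x (Suc (Suc i))) \<and>
        w \<bullet> e2 = \<alpha> * py (x (Suc i)) + \<beta> * py (x (Suc (Suc i)))"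
      using le wc[of i "Suc i"] wc[of "Suc (Suc i)" "Suc i"]
      by (intro maximal_functional_in_cone[OF fanD(5)[OF x] fanD(5)[OF x] fanD(5)[OF x]])
        (simp_all add: inner_diff_right)
    then obtain \<alpha> \<beta>' where ab: "0 \<le> \<alpha>" "0 \<le> \<beta>'"
      "w \<bullet> e1 = \<alpha> * px (x (Suc i)) + \<beta>' * px (x (Suc (Suc i)))"
      "w \<bullet> e2 = \<alpha> * py (x (Suc i)) + \<beta>' * py (x (Suc (Suc i)))" by blast
    have hc: "h j \<bullet> (c k - c l) = px (x (Suc j)) * (ccx (x k) (x (Suc k)) - ccx (x l) (x (Suc l))) +
        py (x (Suc j)) * (ccy (x k) (x (Suc k)) - ccy (x l) (x (Suc l)))" for j k l
      unfolding c_def inner_pt_diff by (simp add: h_def inner_add_left e11 e22 e12 e21)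
    have "w \<bullet> (c k - c (Suc i)) = \<alpha> * (h i \<bullet> (c k - c (Suc i))) + \<beta>' * (h (Suc i) \<bullet> (c k - c (Suc i)))" for k
      unfolding wc ab(3,4) hc by (simp add: algebra_simps)
    then show "\<exists>x\<ge>0. \<exists>y\<ge>0. \<forall>k. w \<bullet> (c k - c (Suc i)) =
        x * (h i \<bullet> (c k - c (Suc i))) + y * (h (Suc i) \<bullet> (c k - c (Suc i)))"
      using ab(1,2) by blast
  qed
qed

subsection \<open>The cyclic order around the edge\<close>

lemma tri_face_iff:
  "f \<in> K \<and> 2 simplex f \<and> convex hull {a, b} face_of f \<longleftrightarrow> (\<exists>u. tri u \<and> f = tri_hull u)"
proof
  assume f: "f \<in> K \<and> 2 simplex f \<and> convex hull {a, b} face_of f"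
  then obtain A where A: "spans_simplex K A" "f = convex hull A"
    using simplicial_complex_obtains[OF K] by metis
  have AB: "{a, b} \<subseteq> A" using spans_simplex_face_iff[OF K edge A(1)] f A(2) by simp
  have "card A = 3" using spans_simplex_simplex_iff[OF A(1), of 2] f A(2) by simp
  then have "card (A - {a, b}) = 1" using AB ab by (subst card_Diff_subset) auto
  then obtain u where "A - {a, b} = {u}" by (rule card_1_singletonE)
  then have "A = {a, b, u}" "u \<notin> {a, b}" using AB by auto
  then show "\<exists>u. tri u \<and> f = tri_hull u" using A by (auto simp: tri_def)
next
  assume "\<exists>u. tri u \<and> f = tri_hull u"
  then obtain u where u: "tri u" "f = tri_hull u" by blast
  have "convex hull {a, b} face_of tri_hull u"
    using spans_simplex_face_iff[OF K edge, of "{a, b, u}"] u by (auto simp: tri_def)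
  then show "f \<in> K \<and> 2 simplex f \<and> convex hull {a, b} face_of f"
    using tri_simplex u by simp
qed

lemma tet_pos: "tet v w \<Longrightarrow> pos v w \<or> pos w v"
  using tet_turn[of v w] turn_swap[of w v] tet_swap by (auto simp: pos_def)

lemma tet_face_iff:
  "\<sigma> \<in> K \<and> 3 simplex \<sigma> \<and> convex hull {a, b} face_of \<sigma> \<longleftrightarrow> (\<exists>v w. pos v w \<and> \<sigma> = tet_hull v w)"
proof
  assume f: "\<sigma> \<in> K \<and> 3 simplex \<sigma> \<and> convex hull {a, b} face_of \<sigma>"
  then obtain A where A: "spans_simplex K A" "\<sigma> = convex hull A"
    using simplicial_complex_obtains[OF K] by metis
  have AB: "{a, b} \<subseteq> A" using spans_simplex_face_iff[OF K edge A(1)] f A(2) by simp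
  have card: "card A = 4" using spans_simplex_simplex_iff[OF A(1), of 3] f A(2) by simp
  then have "card (A - {a, b}) = 2" using AB ab by (subst card_Diff_subset) auto
  then obtain v w where "A - {a, b} = {v, w}" by (auto simp: card_2_iff)
  then have eq: "A = {a, b, v, w}" using AB by auto
  then have "tet v w" using A(1) card by (simp add: tet_def)
  moreover have "tet_hull v w = tet_hull w v" by (simp add: insert_commute)
  ultimately show "\<exists>v w. pos v w \<and> \<sigma> = tet_hull v w" using tet_pos A(2) eq by metis
next
  assume "\<exists>v w. pos v w \<and> \<sigma> = tet_hull v w"
  then obtain v w where u: "tet v w" "\<sigma> = tet_hull v w" by (auto simp: pos_def)
  have "convex hull {a, b} face_of tet_hull v w"
    using spans_simplex_face_iff[OF K edge, of "{a, b, v, w}"] u by (auto simp: tet_def)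
  then show "\<sigma> \<in> K \<and> 3 simplex \<sigma> \<and> convex hull {a, b} face_of \<sigma>"
    using tet_in_K u by simp
qed

lemma triangle_face_iff:
  assumes "tri u" "tet v w"
  shows "tri_hull u face_of tet_hull v w \<longleftrightarrow> u = v \<or> u = w"
  using spans_simplex_face_iff[OF K, of "{a, b, u}" "{a, b, v, w}"] assms
  by (auto simp: tri_def tet_def)

lemma triangle_eq_iff: "tri u \<Longrightarrow> tri v \<Longrightarrow> tri_hull u = tri_hull v \<longleftrightarrow> u = v"
  using spans_simplex_eq_iff[OF K, of "{a, b, u}" "{a, b, v}"] by (auto simp: tri_def)

lemma tetrahedron_eq_iff:
  assumes "pos v w" "pos v' w'"
  shows "tet_hull v w = tet_hull v' w' \<longleftrightarrow> v = v' \<and> w = w'"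
proof
  assume "tet_hull v w = tet_hull v' w'"
  then have "{a, b, v, w} = {a, b, v', w'}"
    using spans_simplex_eq_iff[OF K, of "{a, b, v, w}" "{a, b, v', w'}"] assms
      by (simp add: pos_def tet_def)
  moreover have "{v, w} = {a, b, v, w} - {a, b}" "{v', w'} = {a, b, v', w'} - {a, b}"
    using pos_tri[OF assms(1)] pos_tri[OF assms(2)] by (auto simp: tri_def)
  ultimately have "{v, w} = {v', w'}" by simp
  then show "v = v' \<and> w = w'" using assms pos_asym by (auto simp: doubleton_eq_iff)
qed simp

lemma fan_pos:
  assumes x: "fan N x" and "pos v w"
  shows "\<exists>i<N. v = x i \<and> w = x (Suc i)"
proof -
  obtain i where i: "i < N" "v = x i" using fan_covers[OF x pos_tri(1)[OF assms(2)]] by blast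
  then have "w = x (Suc i)" using pos_functional assms(2) fanD(5)[OF x] by metis
  then show ?thesis using i by blast
qed

lemma fan_tetrahedron_eq_iff:
  assumes x: "fan N x" and "i < N" "j < N"
  shows "tet_hull (x i) (x (Suc i)) = tet_hull (x j) (x (Suc j)) \<longleftrightarrow> i = j"
  using tetrahedron_eq_iff[OF fanD(5)[OF x] fanD(5)[OF x]] fan_eq_iff[OF assms] by auto

lemma fan_tetrahedra:
  assumes x: "fan N x"
  shows "{\<sigma> \<in> K. 3 simplex \<sigma> \<and> convex hull {a, b} face_of \<sigma>} =
    (\<lambda>i. tet_hull (x i) (x (Suc i))) ` {..<N}"
proof -
  have "{\<sigma> \<in> K. 3 simplex \<sigma> \<and> convex hull {a, b} face_of \<sigma>} = {\<sigma>. \<exists>v w. pos v w \<and> \<sigma> = tet_hull v w}"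
    using tet_face_iff by blast
  also have "\<dots> = (\<lambda>i. tet_hull (x i) (x (Suc i))) ` {..<N}"
    using fan_pos[OF x] fanD(5)[OF x] by blast
  finally show ?thesis .
qed

lemma fan_cyclic_order:
  assumes x: "fan N x"
  shows "cyclic_order_around K (convex hull {a, b}) (map (\<lambda>i. tet_hull (x i) (x (Suc i))) [0..<N])"
  unfolding cyclic_order_around_def Let_def
proof (intro conjI allI impI)
  let ?ts = "map (\<lambda>i. tet_hull (x i) (x (Suc i))) [0..<N]"
  show "distinct ?ts"
    using fan_tetrahedron_eq_iff[OF x] by (auto simp: distinct_map inj_on_def)
  show "set ?ts = {\<sigma> \<in> K. 3 simplex \<sigma> \<and> convex hull {a, b} face_of \<sigma>}"
    unfolding fan_tetrahedra[OF x] by (simp add: atLeast0LessThan)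
  fix i assume i: "i < length ?ts"
  have "Suc i mod N < N" using i by simp
  then have "?ts ! (Suc i mod length ?ts) = tet_hull (x (Suc i)) (x (Suc (Suc i)))"
    using fan_mod[OF x, of "Suc i"] by simp
  \<comment> \<open>Otherwise the two consecutive tetrahedra would coincide.\<close>
  moreover have "x (Suc (Suc i)) \<noteq> x i" using fanD(5)[OF x] pos_asym by metis
  ultimately have "?ts ! i \<inter> ?ts ! (Suc i mod length ?ts) = tri_hull (x (Suc i))"
    using i tet_Int_tet fanD(5)[OF x] by (simp add: pos_def)
  then show "2 simplex (?ts ! i \<inter> ?ts ! (Suc i mod length ?ts))"
    "convex hull {a, b} face_of ?ts ! i \<inter> ?ts ! (Suc i mod length ?ts)"
    using tri_face_iff fanD(6)[OF x] by metis+
qed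

text \<open>The second alternative is a fan for the opposite orientation.\<close>

lemma cyclic_order_fan:
  assumes "cyclic_order_around K (convex hull {a, b}) ts"
  obtains x where "fan (length ts) x" "\<And>i. i < length ts \<Longrightarrow> ts ! i = tet_hull (x i) (x (Suc i))"
  | y where "3 \<le> length ts" "\<And>i. y (i + length ts) = y i" "inj_on y {..<length ts}" "\<And>i. pos (y (Suc i)) (y i)"
    "\<And>i. i < length ts \<Longrightarrow> ts ! i = tet_hull (y (Suc i)) (y i)"
proof -
  let ?n = "length ts"
  have dist: "distinct ts" and set: "set ts = {\<sigma> \<in> K. 3 simplex \<sigma> \<and> convex hull {a, b} face_of \<sigma>}"
    and adj: "\<And>i. i < ?n \<Longrightarrow> 2 simplex (ts ! i \<inter> ts ! (Suc i mod ?n))"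
    using assms by (auto simp: cyclic_order_around_def Let_def)
  \<comment> \<open>This fan serves for counting: it shows that \<open>ts\<close> has at least three
    members. The apices are then read off from \<open>ts\<close> itself.\<close>
  obtain N x where x: "fan N x" using ex_fan by blast
  have "card (set ts) = N"
    unfolding set fan_tetrahedra[OF x] using fan_tetrahedron_eq_iff[OF x]
    by (subst card_image) (auto simp: inj_on_def)
  then have n: "3 \<le> ?n" using distinct_card[OF dist] fanD(1)[OF x] by simp
  then have n0: "0 < ?n" by linarith
  have "\<exists>v w. pos v w \<and> ts ! (i mod ?n) = tet_hull v w" for i
  proof -
    have "ts ! (i mod ?n) \<in> set ts" by (intro nth_mem mod_less_divisor n0)
    then show ?thesis using set tet_face_iff by blast
  qed
  then obtain Y Z where YZ: "\<And>i. pos (Y i) (Z i)" "\<And>i. ts ! (i mod ?n) = tet_hull (Y i) (Z i)"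
    by metis
  define y z where "y i = Y (i mod ?n)" and "z i = Z (i mod ?n)" for i
  have pos: "pos (y i) (z i)" and ts: "ts ! (i mod ?n) = tet_hull (y i) (z i)" for i
    using YZ[of "i mod ?n"] by (auto simp: y_def z_def)
  have per: "y (i + ?n) = y i" "z (i + ?n) = z i" for i by (auto simp: y_def z_def)
  have y_eq: "i mod ?n = j mod ?n" if "y i = y j \<or> z i = z j" for i j
  proof -
    have "y i = y j" "z i = z j"
      using that pos[of i] pos[of j] pos_functional pos_injective by metis+
    then have "ts ! (i mod ?n) = ts ! (j mod ?n)" using ts by simp
    moreover have "i mod ?n < ?n" "j mod ?n < ?n" by (rule mod_less_divisor[OF n0])+
    ultimately show ?thesis using dist nth_eq_iff_index_eq by blast
  qed
  have inj: "inj_on y {..<?n}" "inj_on z {..<?n}"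
    using y_eq by (force simp: inj_on_def)+
  \<comment> \<open>Otherwise two consecutive tetrahedra would have just the edge in common.\<close>
  have step: "z i = y (Suc i) \<or> y i = z (Suc i)" for i
  proof (rule ccontr)
    assume neg: "\<not> ?thesis"
    have ne: "y i \<noteq> y (Suc i)" "z i \<noteq> z (Suc i)"
      using y_eq[of i "Suc i"] n by (auto simp: mod_Suc split: if_splits)
    have s: "spans_simplex K {a, b, y i, z i}" "spans_simplex K {a, b, y (Suc i), z (Suc i)}"
      using pos by (auto simp: pos_def tet_def)
    have nab: "y i \<notin> {a, b}" "z i \<notin> {a, b}"
      using pos_tri[OF pos[of i]] by (auto simp: tri_def)
    have "{a, b, y i, z i} \<inter> {a, b, y (Suc i), z (Suc i)} = {a, b}"
      using neg ne nab by auto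
    then have "tet_hull (y i) (z i) \<inter> tet_hull (y (Suc i)) (z (Suc i)) = convex hull {a, b}"
      using convex_hull_Int_simplicial_complex[OF K s] by simp
    moreover have "2 simplex (ts ! (i mod ?n) \<inter> ts ! (Suc (i mod ?n) mod ?n))"
      by (intro adj mod_less_divisor n0)
    ultimately have "2 simplex (convex hull {a, b})"
      using ts[of i] ts[of "Suc i"] by (simp add: mod_Suc_eq)
    then show False
      using spans_simplex_simplex_iff[OF edge, of 2] ab by simp
  qed
  \<comment> \<open>A change of direction would give tetrahedra \<open>i\<close> and
    \<open>i + 2\<close> the same final apex and so make them equal, impossible for length at least
    3.\<close>
  have fwd: "z (Suc i) = y (Suc (Suc i))" if "z i = y (Suc i)" for i
  proof (rule ccontr)
    assume "\<not> ?thesis"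
    then have "y (Suc i) = z (Suc (Suc i))" using step[of "Suc i"] by auto
    then have "Suc (Suc i) mod ?n = i mod ?n" using that y_eq by metis
    then show False using Suc_Suc_mod_neq[OF n] by simp
  qed
  show thesis
  proof (cases "z 0 = y (Suc 0)")
    case True
    have zy: "z i = y (Suc i)" for i by (induction i) (auto intro: fwd True)
    have "fan ?n y" using n per inj(1) pos by (simp add: fan_def flip: zy)
    moreover have "ts ! i = tet_hull (y i) (y (Suc i))" if "i < ?n" for i
      using ts[of i] that zy by simp
    ultimately show thesis by (rule that(1))
  next
    case False
    have "z i \<noteq> y (Suc i)" for i
    proof
      assume i: "z i = y (Suc i)"
      \<comment> \<open>The direction persists up to a multiple of the length, which represents
        index 0.\<close>
      have "z (i + k) = y (Suc (i + k))" for k by (induction k) (auto simp: i intro: fwd)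
      moreover have "i + (i * ?n - i) = i * ?n" using n0 by (cases ?n) auto
      ultimately have "z (i * ?n) = y (Suc (i * ?n))" by metis
      moreover have "z (i * ?n) = z 0" "y (Suc (i * ?n)) = y (Suc 0)"
        by (simp_all add: y_def z_def mod_Suc)
      ultimately show False using False by simp
    qed
    then have yz: "y i = z (Suc i)" for i using step by blast
    have "pos (z (Suc i)) (z i)" for i using pos[of i] unfolding yz .
    moreover have "ts ! i = tet_hull (z (Suc i)) (z i)" if "i < ?n" for i
      using ts[of i] that yz by simp
    ultimately show thesis using n per(2) inj(2) by (intro that(2))
  qed
qed

subsection \<open>The signed area\<close>

lemma extreme_point_spans_simplex:
  "spans_simplex K A \<Longrightarrow> v extreme_point_of (convex hull A) \<longleftrightarrow> v \<in> A"
  by (simp add: spans_simplex_def extreme_point_of_convex_hull_affine_independent)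

lemma sum_squares_pos: "tri u \<Longrightarrow> 0 < (px u)\<^sup>2 + (py u)\<^sup>2"
  using tri_nonzero[of u] by (simp add: sum_power2_gt_zero_iff)

text \<open>Within the plane of the triangle, \<open>lin u\<close> vanishes exactly on the edge
  line, is positive at \<open>u\<close>, and has the sign of \<open>foot u\<close> at the
  circumcenter.\<close>

lemma facet_sign_edge:
  assumes u: "tri u"
  shows "facet_sign (convex hull {a, b}) (tri_hull u) = (if 0 < foot u then 1 else -1)"
proof -
  let ?g = "px u *\<^sub>R e1 + py u *\<^sub>R e2" and ?c = "pt (foot u * px u) (foot u * py u)"
  have g: "?g \<bullet> z - ?g \<bullet> m = lin u z" for z
    by (simp add: lin_def px_affine[of z] py_affine[of z] inner_add_left right_diff_distrib)
  have u': "\<not> affine_dependent {a, b, u}" "u \<notin> {a, b}"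
    using u by (auto simp: tri_def spans_simplex_def)
  note nz = tri_nonzero[OF u]
  have g0: "?g \<bullet> z = ?g \<bullet> m \<longleftrightarrow> lin u z = 0" for z using g[of z] by linarith
  have "px z = 0 \<and> py z = 0 \<longleftrightarrow> turn u z = 0 \<and> lin u z = 0" for z
  proof
    assume "turn u z = 0 \<and> lin u z = 0"
    then have "((px u)\<^sup>2 + (py u)\<^sup>2) * px z = 0" "((px u)\<^sup>2 + (py u)\<^sup>2) * py z = 0"
      unfolding turn_def lin_def by algebra+
    then show "px z = 0 \<and> py z = 0" using sum_squares_pos[OF u] by auto
  qed (simp add: turn_def lin_def)
  then have hull: "affine hull (convex hull {a, b}) = affine hull (tri_hull u) \<inter> {z. ?g \<bullet> z = ?g \<bullet> m}"
    unfolding affine_hull_convex_hull affine_hull_edge affine_hull_triangle[OF nz] g0 by auto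
  have c: "circumcenter (tri_hull u) = ?c" by (rule circumcenter_triangle[OF u'])
  have "turn u ?c = 0" by (simp add: turn_def)
  then have cin: "?c \<in> affine hull (tri_hull u)" "u \<in> affine hull (tri_hull u)"
    unfolding affine_hull_convex_hull affine_hull_triangle[OF nz] by auto
  have "same_half_space (convex hull {a, b}) (tri_hull u) ?c u \<longleftrightarrow> 0 < lin u ?c * lin u u"
    using same_half_space_iff[OF hull cin] by (simp add: g)
  also have "lin u ?c * lin u u = foot u * ((px u)\<^sup>2 + (py u)\<^sup>2)\<^sup>2"
    by (simp add: lin_pt lin_def power2_eq_square algebra_simps)
  also have "0 < \<dots> \<longleftrightarrow> 0 < foot u"
    using nz by (auto simp: zero_less_mult_iff)
  finally have s: "same_half_space (convex hull {a, b}) (tri_hull u) ?c u \<longleftrightarrow> 0 < foot u" .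
  have "u \<notin> affine hull {a, b}" using nz by (auto simp: affine_hull_edge)
  then have "u \<notin> convex hull {a, b}" using convex_hull_subset_affine_hull by blast
  moreover have "{a, b} \<subseteq> convex hull {a, b}" by (rule hull_subset)
  ultimately have "v extreme_point_of tri_hull u \<and> v \<notin> convex hull {a, b} \<longleftrightarrow> v = u" for v
    using extreme_point_spans_simplex[of "{a, b, u}"] u by (auto simp: tri_def)
  then show ?thesis unfolding facet_sign_def c using s by metis
qed

lemma facet_sign_triangle:
  assumes "tet u z"
  shows "facet_sign (tri_hull u) (tet_hull u z) = (if 0 < turn u (cc u z) * turn u z then 1 else -1)"
proof -
  let ?g = "px u *\<^sub>R e2 - py u *\<^sub>R e1"
  have u: "tri u" using tet_tri assms by blast
  note nz = tri_nonzero[OF u]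
  have t: "\<not> affine_dependent {a, b, u, z}" "card {a, b, u, z} = 4" "spans_simplex K {a, b, u, z}"
    using assms by (auto simp: tet_def spans_simplex_def)
  have U: "affine hull (tet_hull u z) = UNIV"
    unfolding affine_hull_convex_hull by (rule affine_hull_tetrahedron[OF t(1,2)])
  have hull: "affine hull (tri_hull u) = affine hull (tet_hull u z) \<inter> {z. ?g \<bullet> z = ?g \<bullet> m}"
    unfolding U
      unfolding affine_hull_convex_hull affine_hull_triangle[OF nz] by (auto simp: turn_affine)
  have c: "circumcenter (tet_hull u z) = cc u z" using tet_in_K[OF assms] by simp
  have s: "same_half_space (tri_hull u) (tet_hull u z) (cc u z) z \<longleftrightarrow> 0 < turn u (cc u z) * turn u z"
    using same_half_space_iff[OF hull] by (simp only: U UNIV_I turn_affine[of u])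
  have "z \<notin> affine hull {a, b, u}"
    using tet_turn[OF assms] by (simp add: affine_hull_triangle[OF nz])
  then have "z \<notin> tri_hull u" using convex_hull_subset_affine_hull by blast
  moreover have "{a, b, u} \<subseteq> tri_hull u" by (rule hull_subset)
  ultimately have "v extreme_point_of tet_hull u z \<and> v \<notin> tri_hull u \<longleftrightarrow> v = z" for v
    using extreme_point_spans_simplex[OF t(3)] by auto
  then show ?thesis unfolding facet_sign_def c using s by metis
qed

lemma triangle_area_pt:
  "triangle_area m (pt (r * px u) (r * py u)) (pt X Y) = \<bar>r * turn u (pt X Y)\<bar> / 2"
proof -
  have "cross3 (pt (r * px u) (r * py u) - m) (pt X Y - m) = (r * turn u (pt X Y)) *\<^sub>R cross3 e1 e2"
  proof -
    have "pt (r * px u) (r * py u) - m = (r * px u) *\<^sub>R e1 + (r * py u) *\<^sub>R e2"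
      "pt X Y - m = X *\<^sub>R e1 + Y *\<^sub>R e2" by (simp_all add: pt_def)
    moreover have "turn u (pt X Y) = px u * Y - py u * X" by (simp add: turn_def)
    ultimately show ?thesis by (simp only:) (simp add: cross3_simps)
  qed
  moreover have "(norm (cross3 e1 e2))\<^sup>2 = 1"
    unfolding norm_cross by (simp add: power2_norm_eq_inner e11 e22 e12)
  then have "norm (cross3 e1 e2) = 1" by (smt (verit) norm_ge_zero power2_eq_1_iff)
  ultimately show ?thesis by (simp add: triangle_area_def)
qed

definition "signed_term = (\<lambda>(f, \<sigma>). facet_sign (convex hull {a, b}) f * facet_sign f \<sigma> *
    triangle_area (circumcenter (convex hull {a, b})) (circumcenter f) (circumcenter \<sigma>))"

lemma signed_term_tet:
  assumes "tet u z"
  shows "signed_term (tri_hull u, tet_hull u z) = sgn (turn u z) * (foot u * turn u (cc u z)) / 2"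
proof -
  have u: "tri u" using tet_tri assms by blast
  then have c: "circumcenter (tri_hull u) = pt (foot u * px u) (foot u * py u)"
    by (intro circumcenter_triangle) (auto simp: tri_def spans_simplex_def)
  \<comment> \<open>The facet signs undo the absolute value up to the orientation of the
    tetrahedron; if the product vanishes, so does the area.\<close>
  have *: "(if 0 < f then 1 else -1) * (if 0 < t * s then 1 else -1) * (\<bar>f * t\<bar> / 2) = sgn s * (f * t) / 2"
    if "s \<noteq> 0" for f t s :: real
    using that by (auto simp: sgn_if abs_if zero_less_mult_iff mult_less_0_iff)
  show ?thesis
    unfolding signed_term_def prod.case facet_sign_edge[OF u] facet_sign_triangle[OF assms]
      circumcenter_edge c tet_in_K(3)[OF assms] triangle_area_pt
    by (rule *[OF tet_turn[OF assms]])
qed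

lemma cc_swap: "cc w v = cc v w"
proof -
  have "ccx w v = (bis w * py v - bis v * py w) / - turn v w"
    "ccy w v = (px w * bis v - px v * bis w) / - turn v w"
    by (simp_all add: ccx_def ccy_def turn_swap[of v w])
  then show ?thesis
    by (simp add: ccx_def ccy_def flip: minus_divide_left) (simp flip: minus_divide_left add: diff_divide_distrib)
qed

lemma signed_term_pos:
  assumes "pos v w"
  shows "signed_term (tri_hull v, tet_hull v w) = foot v * turn v (cc v w) / 2"
    and "signed_term (tri_hull w, tet_hull v w) = - foot w * turn w (cc v w) / 2"
proof -
  have t: "tet v w" "0 < turn v w" using assms by (auto simp: pos_def)
  show "signed_term (tri_hull v, tet_hull v w) = foot v * turn v (cc v w) / 2"
    using signed_term_tet[OF t(1)] t(2) by simp
  have "tet_hull w v = tet_hull v w" by (simp add: insert_commute)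
  moreover have "sgn (turn w v) = -1" using t(2) turn_swap[of w v] by simp
  ultimately show "signed_term (tri_hull w, tet_hull v w) = - foot w * turn w (cc v w) / 2"
    using signed_term_tet[OF tet_swap[OF t(1)]] by (simp add: cc_swap[of w v])
qed

text \<open>Each tetrahedron has two triangles at the edge and so contributes two chains. Grouped by
  triangle instead, the two chains of a triangle give the signed area spanned by \<open>m\<close>
  and the two adjacent circumcenters.\<close>

lemma signed_area_fan:
  assumes x: "fan N x"
  shows "signed_dual_area K (convex hull {a, b}) =
    (\<Sum>i<N. foot (x (Suc i)) * (turn (x (Suc i)) (cc (x (Suc i)) (x (Suc (Suc i)))) - turn (x (Suc i)) (cc (x i) (x (Suc i))))) / 2"
proof -
  let ?T = "\<lambda>i. tet_hull (x i) (x (Suc i))"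
  let ?A = "(\<lambda>i. (tri_hull (x i), ?T i)) ` {..<N}" and ?B = "(\<lambda>i. (tri_hull (x (Suc i)), ?T i)) ` {..<N}"
  let ?P = "{(f, \<sigma>). f \<in> K \<and> \<sigma> \<in> K \<and> 2 simplex f \<and> 3 simplex \<sigma> \<and>
      convex hull {a, b} face_of f \<and> f face_of \<sigma>}"
  let ?g = "\<lambda>i. foot (x i) * turn (x i) (cc (x i) (x (Suc i)))"
  note pos = fanD(5)[OF x]
  have tet: "tet (x i) (x (Suc i))" for i using pos by (simp add: pos_def)
  have P: "?P = ?A \<union> ?B"
  proof
    show "?P \<subseteq> ?A \<union> ?B"
    proof
      fix z assume "z \<in> ?P"
      then obtain f \<sigma> where z: "z = (f, \<sigma>)" "f \<in> K" "2 simplex f" "convex hull {a, b} face_of f"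
        "\<sigma> \<in> K" "3 simplex \<sigma>" "f face_of \<sigma>" by auto
      then obtain u where u: "tri u" "f = tri_hull u" using tri_face_iff by blast
      have "convex hull {a, b} face_of \<sigma>" using z face_of_trans by blast
      then have "\<sigma> \<in> ?T ` {..<N}" using fan_tetrahedra[OF x] z by blast
      then obtain i where i: "i < N" "\<sigma> = ?T i" by blast
      then have "u = x i \<or> u = x (Suc i)" using triangle_face_iff[OF u(1) tet] z(7) u(2) by blast
      then show "z \<in> ?A \<union> ?B" using z(1) u(2) i by blast
    qed
    show "?A \<union> ?B \<subseteq> ?P"
    proof
      fix z assume "z \<in> ?A \<union> ?B"
      then obtain i u where z: "u = x i \<or> u = x (Suc i)" "z = (tri_hull u, ?T i)" by blast
      have u: "tri u" using z(1) fanD(6)[OF x] by blast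
      have "?T i \<in> K" "3 simplex ?T i" using tet_in_K[OF tet] by auto
      moreover have "tri_hull u face_of ?T i" using triangle_face_iff[OF u tet] z(1) by blast
      moreover have "tri_hull u \<in> K \<and> 2 simplex (tri_hull u) \<and> convex hull {a, b} face_of (tri_hull u)"
        using tri_face_iff u by blast
      ultimately show "z \<in> ?P" using z(2) by blast
    qed
  qed
  have disj: "?A \<inter> ?B = {}"
  proof -
    have False if ij: "i < N" "j < N" "tri_hull (x i) = tri_hull (x (Suc j))" "?T i = ?T j" for i j
    proof -
      have "i = j" using fan_tetrahedron_eq_iff[OF x ij(1,2)] ij(4) by blast
      then have "x i = x (Suc i)" using triangle_eq_iff fanD(6)[OF x] ij(3) by blast
      then show False using pos[of i] pos_irrefl by simp
    qed
    then show ?thesis by blast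
  qed
  have inj: "inj_on (\<lambda>i. (h i, ?T i)) {..<N}" for h :: "nat \<Rightarrow> (real^3) set"
    using fan_tetrahedron_eq_iff[OF x] by (auto simp: inj_on_def)
  have "signed_dual_area K (convex hull {a, b}) = sum signed_term ?P"
    unfolding signed_dual_area_def signed_term_def ..
  also have "\<dots> = sum signed_term ?A + sum signed_term ?B"
    unfolding P by (intro sum.union_disjoint disj) auto
  also have "\<dots> = (\<Sum>i<N. signed_term (tri_hull (x i), ?T i)) + (\<Sum>i<N. signed_term (tri_hull (x (Suc i)), ?T i))"
    by (simp add: sum.reindex[OF inj] o_def)
  also have "\<dots> = (\<Sum>i<N. ?g i / 2) + (\<Sum>i<N. - foot (x (Suc i)) * turn (x (Suc i)) (cc (x i) (x (Suc i))) / 2)"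
    by (simp only: signed_term_pos[OF pos])
  \<comment> \<open>The shift brings both chains of a triangle to the same index; by periodicity the
    terms at 0 and \<open>N\<close> agree.\<close>
  also have "(\<Sum>i<N. ?g i / 2) = (\<Sum>i<N. ?g (Suc i) / 2)"
  proof -
    have "?g 0 = ?g N" using fanD(2)[OF x, of 0] fanD(3)[OF x, of 0] by simp
    then show ?thesis using sum.lessThan_Suc_shift[of "\<lambda>i. ?g i / 2" N] by simp
  qed
  also have "\<dots> + (\<Sum>i<N. - foot (x (Suc i)) * turn (x (Suc i)) (cc (x i) (x (Suc i))) / 2) =
      (\<Sum>i<N. foot (x (Suc i)) * (turn (x (Suc i)) (cc (x (Suc i)) (x (Suc (Suc i)))) - turn (x (Suc i)) (cc (x i) (x (Suc i))))) / 2"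
    unfolding sum.distrib[symmetric] sum_divide_distrib
      by (intro sum.cong refl) (simp add: field_simps)
  finally show ?thesis .
qed

text \<open>
  The edge of the dual polygon dual to the triangle with apex \<open>w = x (Suc i)\<close> is \<open>t i\<close> times the
  rotated normal of its line, so the signed area is half the sum of the \<open>t i * bis w\<close>. As the
  polygon closes up, the origin may be moved to one of its vertices, where all terms are nonnegative.
\<close>

lemma signed_area_pos:
  assumes x: "fan N x"
  shows "0 < signed_dual_area K (convex hull {a, b})"
proof -
  note pos = fanD(5)[OF x]
  let ?w = "\<lambda>i. x (Suc i)"
  let ?X = "\<lambda>i. ccx (x i) (x (Suc i))" and ?Y = "\<lambda>i. ccy (x i) (x (Suc i))"
  have "\<exists>t. 0 < t \<and> ?X (Suc i) - ?X i = - t * py (?w i) \<and> ?Y (Suc i) - ?Y i = t * px (?w i)" for i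
    using cc_step[OF pos[of i] pos[of "Suc i"]] by metis
  then obtain t where t: "\<And>i. 0 < t i" "\<And>i. ?X (Suc i) - ?X i = - t i * py (?w i)"
    "\<And>i. ?Y (Suc i) - ?Y i = t i * px (?w i)" by metis
  have "foot (?w i) * (turn (?w i) (pt (?X (Suc i)) (?Y (Suc i))) - turn (?w i) (pt (?X i) (?Y i))) = t i * bis (?w i)" for i
  proof -
    have "turn (?w i) (pt (?X (Suc i)) (?Y (Suc i))) - turn (?w i) (pt (?X i) (?Y i)) =
        px (?w i) * (?Y (Suc i) - ?Y i) - py (?w i) * (?X (Suc i) - ?X i)"
      by (simp add: turn_def algebra_simps)
    also have "\<dots> = t i * ((px (?w i))\<^sup>2 + (py (?w i))\<^sup>2)"
      unfolding t(2,3) by (simp add: power2_eq_square algebra_simps)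
    finally have eq: "turn (?w i) (pt (?X (Suc i)) (?Y (Suc i))) - turn (?w i) (pt (?X i) (?Y i)) =
        t i * ((px (?w i))\<^sup>2 + (py (?w i))\<^sup>2)" .
    have cancel: "\<beta> / d * (s * d) = s * \<beta>" if "0 < d" for \<beta> d s :: real using that by simp
    show ?thesis
      unfolding eq foot_def by (rule cancel[OF sum_squares_pos[OF fanD(6)[OF x]]])
  qed
  then have area: "signed_dual_area K (convex hull {a, b}) = (\<Sum>i<N. t i * bis (?w i)) / 2"
    unfolding signed_area_fan[OF x] by simp
  have closed: "(\<Sum>i<N. t i * px (?w i)) = 0" "(\<Sum>i<N. t i * py (?w i)) = 0"
  proof -
    have "x N = x 0" "x (Suc N) = x (Suc 0)" using fanD(2,3)[OF x, of 0] by auto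
    then have "(\<Sum>i<N. ?X (Suc i) - ?X i) = 0" "(\<Sum>i<N. ?Y (Suc i) - ?Y i) = 0"
      using sum_lessThan_telescope[of ?X N] sum_lessThan_telescope[of ?Y N] by simp_all
    then show "(\<Sum>i<N. t i * px (?w i)) = 0" "(\<Sum>i<N. t i * py (?w i)) = 0"
      unfolding t(2,3) by (simp_all add: sum_negf)
  qed
  let ?c = "cc (x 0) (x 1)"
  have "(\<Sum>i<N. t i * (bis (?w i) - lin (?w i) ?c)) =
      (\<Sum>i<N. t i * bis (?w i)) - ccx (x 0) (x 1) * (\<Sum>i<N. t i * px (?w i)) - ccy (x 0) (x 1) * (\<Sum>i<N. t i * py (?w i))"
    by (simp add: lin_pt sum_distrib_left algebra_simps flip: sum_subtractf)
  also have "\<dots> = (\<Sum>i<N. t i * bis (?w i))" unfolding closed by simp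
  finally have shifted: "(\<Sum>i<N. t i * bis (?w i)) = (\<Sum>i<N. t i * (bis (?w i) - lin (?w i) ?c))" ..
  \<comment> \<open>\<open>?w 1\<close> is \<open>x 2\<close>, the far apex of a tetrahedron
    adjacent to the one with circumcenter \<open>?c\<close>, so its term is strictly
    positive.\<close>
  have p: "tet (x 0) (x 1)" "tet (x 1) (x 2)" "x 2 \<noteq> x 0"
    using pos[of 0] pos[of 1] pos_asym by (auto simp: pos_def numeral_2_eq_2)
  have "0 < (\<Sum>i<N. t i * (bis (?w i) - lin (?w i) ?c))"
  proof (rule sum_pos2)
    show "1 \<in> {..<N}" using fanD(1)[OF x] by simp
    show "0 < t 1 * (bis (?w 1) - lin (?w 1) ?c)"
      using lin_less_bis[OF p] t(1)[of 1] by (simp add: numeral_2_eq_2)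
    show "0 \<le> t i * (bis (?w i) - lin (?w i) ?c)" for i
      using lin_le_bis[OF p(1) fanD(6)[OF x]] t(1)[of i] by simp
  qed simp
  then show ?thesis unfolding area shifted by simp
qed

lemma cyclic_order_polygon:
  assumes ts: "cyclic_order_around K (convex hull {a, b}) ts"
  shows "simple_polygon (map circumcenter ts)" "convex_polygon (map circumcenter ts)"
    "coplanar (set (map circumcenter ts))"
proof -
  have "simple_polygon (map circumcenter ts) \<and> convex_polygon (map circumcenter ts) \<and>
      coplanar (set (map circumcenter ts))"
    using ts
  proof (cases rule: cyclic_order_fan)
    case (1 x)
    have "map circumcenter ts = map (\<lambda>i. circumcenter (tet_hull (x i) (x (Suc i)))) [0..<length ts]"
      by (rule nth_equalityI) (simp_all add: 1(2))
    then show ?thesis using fan_polygon[OF 1(1)] by simp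
  next
    case (2 y)
    \<comment> \<open>Mirroring the frame changes the sign of \<open>turn\<close>, so a list running
      in the opposite direction becomes a fan.\<close>
    interpret flip: delaunay_edge a b e1 "- e2" K
      using K delaunay edge interior by unfold_locales (simp_all add: ab e11 e22 e12 e1ab e2ab)
    have "flip.turn v w = turn w v" for v w
      by (simp add: flip.turn_def turn_def flip.py_def py_def)
    then have "flip.fan (length ts) y"
      using 2 by (auto simp: flip.fan_def flip.pos_def pos_def intro: tet_swap)
    then have *: "simple_polygon ps \<and> convex_polygon ps \<and> coplanar (set ps)"
      if "ps = map (\<lambda>i. circumcenter (tet_hull (y i) (y (Suc i)))) [0..<length ts]" for ps
      unfolding that using flip.fan_polygon by blast
    have "tet_hull v w = tet_hull w v" for v w by (simp add: insert_commute)
    then show ?thesis by (intro * nth_equalityI) (simp_all add: 2(5))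
  qed
  then show "simple_polygon (map circumcenter ts)" "convex_polygon (map circumcenter ts)"
    "coplanar (set (map circumcenter ts))" by blast+
qed

end

section \<open>Existence of a frame, and conclusion\<close>

lemma ex_edge_frame:
  fixes a b :: "real^3"
  assumes "a \<noteq> b"
  obtains e1 e2 where "edge_frame a b e1 e2"
proof -
  obtain y where y: "y \<noteq> 0" "(b - a) \<bullet> y = 0"
    using orthogonal_to_vector_exists[of "b - a"] by (auto simp: orthogonal_def)
  define e1 where "e1 = y /\<^sub>R norm y"
  have e1: "norm e1 = 1" "(b - a) \<bullet> e1 = 0" using y by (auto simp: e1_def)
  define z where "z = cross3 (b - a) e1"
  have "(norm z)\<^sup>2 = (norm (b - a))\<^sup>2" unfolding z_def norm_cross by (simp add: e1)
  then have z: "z \<noteq> 0" using assms by auto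
  define e2 where "e2 = z /\<^sub>R norm z"
  have e2: "norm e2 = 1" using z by (simp add: e2_def)
  have "edge_frame a b e1 e2"
  proof
    show "e1 \<bullet> e1 = 1" "e2 \<bullet> e2 = 1" using e1 e2 by (simp_all add: norm_eq_1)
    show "e1 \<bullet> (b - a) = 0" using e1 by (simp add: inner_commute)
    show "e1 \<bullet> e2 = 0" "e2 \<bullet> (b - a) = 0"
      by (simp_all add: e2_def z_def dot_cross_self inner_commute)
  qed (fact assms)
  then show ?thesis by (rule that)
qed

theorem theorem5:
  fixes K :: "(real^3) set set" and \<tau> :: "(real^3) set"
  assumes "tetrahedral_triangulation K"
    and "nondegenerate_delaunay K"
    and "internal_edge K \<tau>"
  shows "(\<exists>ps. circumcentric_dual K \<tau> ps) \<and>
    (\<forall>ps. circumcentric_dual K \<tau> ps \<longrightarrow>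
       simple_polygon ps \<and> coplanar (set ps) \<and> convex_polygon ps) \<and>
    0 < signed_dual_area K \<tau>"
proof -
  have K: "simplicial_complex K" using assms(1) by (simp add: tetrahedral_triangulation_def)
  have \<tau>: "\<tau> \<in> K" "1 simplex \<tau>" "\<not> \<tau> \<subseteq> manifold_boundary (\<Union>K)"
    using assms(3) by (auto simp: internal_edge_def)
  obtain A where A: "spans_simplex K A" "\<tau> = convex hull A"
    using simplicial_complex_obtains[OF K \<tau>(1)] .
  have "card A = 2" using spans_simplex_simplex_iff[OF A(1), of 1] \<tau>(2) A(2) by simp
  then obtain a b where Aab: "A = {a, b}" "a \<noteq> b" by (auto simp: card_2_iff)
  obtain e1 e2 where "edge_frame a b e1 e2" using ex_edge_frame[OF Aab(2)] .
  then interpret edge_frame a b e1 e2 .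
  obtain p where p: "p \<in> \<tau>" "p \<notin> manifold_boundary (\<Union>K)" using \<tau>(3) by blast
  then have "p \<in> interior (\<Union>K)" using manifold_interior_point \<tau>(1) by blast
  \<comment> \<open>The point \<open>p\<close> may be an end of the edge. Since the open edge is
    dense in \<open>\<tau>\<close>, the open set \<open>interior (\<Union>K)\<close> meets it
    too.\<close>
  moreover have "closure (rel_interior \<tau>) = closure \<tau>"
    using A(2) by (simp add: convex_closure_rel_interior)
  then have "p \<in> closure (rel_interior \<tau>)" using p(1) closure_subset by blast
  ultimately have "interior (\<Union>K) \<inter> rel_interior \<tau> \<noteq> {}"
    using open_Int_closure_eq_empty[OF open_interior] by blast
  moreover have \<tau>ab: "\<tau> = convex hull {a, b}" using A(2) Aab(1) by simp
  ultimately have "rel_interior (convex hull {a, b}) \<inter> interior (\<Union>K) \<noteq> {}"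
    by (simp add: Int_commute)
  moreover have "spans_simplex K {a, b}" using A(1) Aab(1) by simp
  ultimately interpret delaunay_edge a b e1 e2 K
    using K assms(2) by unfold_locales
  obtain N x where x: "fan N x" using ex_fan by blast
  show ?thesis
    unfolding \<tau>ab circumcentric_dual_def
    using fan_cyclic_order[OF x] cyclic_order_polygon signed_area_pos[OF x] by blast
qed

end
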